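(* Let $(X_k,Y_k)_{k\in\mathbb{N}}$ be an iid sequence of $\mathbb{R}^2$-valued random vectors with the same distribution as a generic vector $(X,Y)$, and let $m=m(n)$ be integers with $m<n$ and $m\to\infty$ as $n\to\infty$. Let $T_n=\sqrt{n}(\xi_n-\mathbb{E}\xi_n)$, where $\xi_n$ is Chatterjee's rank correlation of $(X_1,Y_1),\ldots,(X_n,Y_n)$, and suppose that $T_n$ converges in distribution to $\mathcal{N}(0,\sigma^2)$ as $n\to\infty$ for some $\sigma^2>0$. Suppose further that one of the following two conditions is fulfilled: (i) $m=o(\sqrt{n})$; (ii) $(X,Y)$ has a continuous distribution function, $Y$ cannot be expressed as a measurable function of $X$ almost surely, and $m=o(n)$. Suppose in addition that the sequence $(T_n)_{n\in\mathbb{N}}$ is uniformly square-integrable. Let $$T_{m,n}^*=\sqrt{m}\left(\xi_m^*-\mathbb{E}\left[\xi_m^*\mid (X_1,Y_1),\ldots,(X_n,Y_n)\right]\right)$$ be the bootstrap statistic, and let $\mathcal{L}(T_{m,n}^* )$ denote its (unconditional) distribution. Then $$d_2\left(\mathcal{L}(T_{m,n}^* ),\mathcal{N}(0,\sigma^2)\right)\longrightarrow 0\quad\text{as } n\to\infty,$$ where $d_2$ is the Wasserstein metric of order $2$.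
   Context: Chatterjee's rank correlation. For data $(x_1,y_1),\ldots,(x_n,y_n)\in\mathbb{R}^2$ ($n\ge 2$), rearrange the pairs as $(x_{(1)},y_{(1)}),\ldots,(x_{(n)},y_{(n)})$ so that $x_{(1)}\le\cdots\le x_{(n)}$, with ties among the $x$-values broken uniformly at random (by auxiliary randomness independent of everything else). Let $r_i=\#\{j: y_{(j)}\le y_{(i)}\}$ be the rank of $y_{(i)}$ and $l_i=\#\{j: y_{(j)}\ge y_{(i)}\}$. If there are no ties among $y_1,\ldots,y_n$, $$\xi_n=1-\frac{3\sum_{i=1}^{n-1}|r_{i+1}-r_i|}{n^2-1},$$ and if there are ties, $$\xi_n=1-\frac{n\sum_{i=1}^{n-1}|r_{i+1}-r_i|}{2\sum_{i=1}^n l_i(n-l_i)}.$$ If $y_1=\cdots=y_n$ (where the formula is $0/0$), $\xi_n$ is assigned an arbitrary fixed value in $[-1,1]$. Bootstrap. Given $(X_1,Y_1),\ldots,(X_n,Y_n)$, draw $m<n$ of these observations uniformly at random without replacement, independently of the sample, giving $(X_1^*,Y_1^* ),\ldots,(X_m^*,Y_m^* )$. Then $\xi_m^*$ is Chatterjee's rank correlation of $(X_1^*,Y_1^* ),\ldots,(X_m^*,Y_m^* )$ (with fresh independent tie-breaking if needed). Conditional quantities given $(X_1,Y_1),\ldots,(X_n,Y_n)$ average over the random resampling and the tie-breaking. Wasserstein metric. For probability measures $\eta,\zeta$ on $\mathbb{R}$, $d_p^p(\eta,\zeta)=\inf_{\gamma}\int|x-y|^p\,\mathrm{d}\gamma(x,y)$,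 the infimum being over all joint distributions $\gamma$ with marginals $\eta$ and $\zeta$. A sequence $(T_n)$ is uniformly square-integrable if $(T_n^2)$ is uniformly integrable. *)

theory Defs
  imports
    "HOL-Probability.Probability"
    "HOL-Combinatorics.Multiset_Permutations"
    "HOL-Library.Landau_Symbols"
begin

text \<open>
  Independence of two random variables whose values may have different types, as opposed to
  \<^const>\<open>prob_space.indep_var\<close>.
\<close>

definition independent_rvs ::
  "'a measure \<Rightarrow> 'b measure \<Rightarrow> ('a \<Rightarrow> 'b) \<Rightarrow> 'c measure \<Rightarrow> ('a \<Rightarrow> 'c) \<Rightarrow> bool" where
  "independent_rvs M N f K g \<longleftrightarrow>
    f \<in> measurable M N \<and> g \<in> measurable M K \<and>
    prob_space.indep_set M
      (sigma_sets (space M) {f -` A \<inter> space M |A. A \<in> sets N})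
      (sigma_sets (space M) {g -` B \<inter> space M |B. B \<in> sets K})"

lemma independent_rvs_iff_indep_var:
  "prob_space M \<Longrightarrow> independent_rvs M N f K g \<longleftrightarrow> prob_space.indep_var M N f K g"
  unfolding independent_rvs_def
  by (simp add: prob_space.indep_var_eq prob_space.indep_set_def)

definition rank_le :: "real list \<Rightarrow> nat \<Rightarrow> nat" where
  "rank_le ys i = card {j. j < length ys \<and> ys ! j \<le> ys ! i}"

definition rank_ge :: "real list \<Rightarrow> nat \<Rightarrow> nat" where
  "rank_ge ys i = card {j. j < length ys \<and> ys ! j \<ge> ys ! i}"

text \<open>
  Chatterjee's coefficient as a function of the \<open>y\<close>-values already listed in the order of
  increasing \<open>x\<close>-values. The number \<open>c\<close> is the value assigned when all \<open>y\<close>-values coincide.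
  The definition is meant for lists of length at least 2.
\<close>

definition xi_sorted :: "real \<Rightarrow> real list \<Rightarrow> real" where
  "xi_sorted c ys =
    (let n = real (length ys);
         D = (\<Sum>i<length ys - 1. \<bar>real (rank_le ys (i + 1)) - real (rank_le ys i)\<bar>)
     in if distinct ys then 1 - 3 * D / (n ^ 2 - 1)
        else if \<forall>i<length ys. ys ! i = ys ! 0 then c
        else 1 - n * D / (2 * (\<Sum>i<length ys. real (rank_ge ys i) * (n - real (rank_ge ys i)))))"

text \<open>
  Here \<open>t\<close> is a list of the indices of the observations. Since \<^const>\<open>sort_key\<close> is stable,
  indices with equal \<open>x\<close>-values keep their order in \<open>t\<close>. Hence, if \<open>t\<close> is a uniformly
  distributed enumeration of the indices that is independent of the data, the ties among the
  \<open>x\<close>-values are broken uniformly at random.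
\<close>

definition chatterjee_xi ::
  "real \<Rightarrow> (nat \<Rightarrow> real) \<Rightarrow> (nat \<Rightarrow> real) \<Rightarrow> nat list \<Rightarrow> real" where
  "chatterjee_xi c x y t = xi_sorted c (map y (sort_key x t))"

text \<open>
  The observations are numbered from \<open>0\<close>, so the sample of size \<open>n\<close> consists of those with
  index in \<open>{..<n}\<close>. The list \<open>t n \<omega>\<close> is the tie-breaking enumeration of \<open>{..<n}\<close>.
\<close>

definition xi_stat ::
  "real \<Rightarrow> (nat \<Rightarrow> 'a \<Rightarrow> real) \<Rightarrow> (nat \<Rightarrow> 'a \<Rightarrow> real) \<Rightarrow> (nat \<Rightarrow> 'a \<Rightarrow> nat list)
    \<Rightarrow> nat \<Rightarrow> 'a \<Rightarrow> real" where
  "xi_stat c X Y t n \<omega> = chatterjee_xi c (\<lambda>k. X k \<omega>) (\<lambda>k. Y k \<omega>) (t n \<omega>)"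

definition T_stat ::
  "'a measure \<Rightarrow> real \<Rightarrow> (nat \<Rightarrow> 'a \<Rightarrow> real) \<Rightarrow> (nat \<Rightarrow> 'a \<Rightarrow> real) \<Rightarrow> (nat \<Rightarrow> 'a \<Rightarrow> nat list)
    \<Rightarrow> nat \<Rightarrow> 'a \<Rightarrow> real" where
  "T_stat M c X Y t n \<omega> =
    sqrt (real n) * (xi_stat c X Y t n \<omega> - prob_space.expectation M (xi_stat c X Y t n))"

text \<open>Possible outcomes of drawing \<open>m\<close> of the indices \<open>0, \<dots>, n - 1\<close> without replacement.\<close>

definition draws :: "nat \<Rightarrow> nat \<Rightarrow> nat list set" where
  "draws m n = {l. length l = m \<and> distinct l \<and> set l \<subseteq> {..<n}}"

text \<open>
  The \<open>j\<close>-th resampled observation is the one with index \<open>s n \<omega> ! j\<close>, where \<open>s n \<omega>\<close> is the drawn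
  list; \<open>u n \<omega>\<close> is the tie-breaking enumeration of the positions in the resample.
\<close>

definition xi_boot ::
  "real \<Rightarrow> (nat \<Rightarrow> 'a \<Rightarrow> real) \<Rightarrow> (nat \<Rightarrow> 'a \<Rightarrow> real) \<Rightarrow> (nat \<Rightarrow> 'a \<Rightarrow> nat list)
    \<Rightarrow> (nat \<Rightarrow> 'a \<Rightarrow> nat list) \<Rightarrow> nat \<Rightarrow> 'a \<Rightarrow> real" where
  "xi_boot c X Y s u n \<omega> =
    chatterjee_xi c (\<lambda>j. X (s n \<omega> ! j) \<omega>) (\<lambda>j. Y (s n \<omega> ! j) \<omega>) (u n \<omega>)"

definition sample_algebra ::
  "'a measure \<Rightarrow> (nat \<Rightarrow> 'a \<Rightarrow> real) \<Rightarrow> (nat \<Rightarrow> 'a \<Rightarrow> real) \<Rightarrow> nat \<Rightarrow> 'a measure" where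
  "sample_algebra M X Y n =
    vimage_algebra (space M) (\<lambda>\<omega>. \<lambda>k\<in>{..<n}. (X k \<omega>, Y k \<omega>)) (Pi\<^sub>M {..<n} (\<lambda>_. borel))"

definition T_boot ::
  "'a measure \<Rightarrow> real \<Rightarrow> (nat \<Rightarrow> 'a \<Rightarrow> real) \<Rightarrow> (nat \<Rightarrow> 'a \<Rightarrow> real) \<Rightarrow> (nat \<Rightarrow> 'a \<Rightarrow> nat list)
    \<Rightarrow> (nat \<Rightarrow> 'a \<Rightarrow> nat list) \<Rightarrow> (nat \<Rightarrow> nat) \<Rightarrow> nat \<Rightarrow> 'a \<Rightarrow> real" where
  "T_boot M c X Y s u m n \<omega> =
    sqrt (real (m n)) * (xi_boot c X Y s u n \<omega>
      - real_cond_exp M (sample_algebra M X Y n) (xi_boot c X Y s u n) \<omega>)"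

definition uniformly_integrable ::
  "'a measure \<Rightarrow> 'i set \<Rightarrow> ('i \<Rightarrow> 'a \<Rightarrow> real) \<Rightarrow> bool" where
  "uniformly_integrable M I f \<longleftrightarrow>
    (\<forall>i\<in>I. integrable M (f i)) \<and>
    (\<forall>e>0. \<exists>K. \<forall>i\<in>I. (LINT x|M. \<bar>f i x\<bar> * indicator {x. K < \<bar>f i x\<bar>} x) \<le> e)"

definition uniformly_square_integrable ::
  "'a measure \<Rightarrow> 'i set \<Rightarrow> ('i \<Rightarrow> 'a \<Rightarrow> real) \<Rightarrow> bool" where
  "uniformly_square_integrable M I f \<longleftrightarrow> uniformly_integrable M I (\<lambda>i x. (f i x)\<^sup>2)"

definition couplings :: "real measure \<Rightarrow> real measure \<Rightarrow> (real \<times> real) measure set" where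
  "couplings \<eta> \<zeta> = {\<gamma>. prob_space \<gamma> \<and> sets \<gamma> = sets borel \<and>
    distr \<gamma> borel fst = \<eta> \<and> distr \<gamma> borel snd = \<zeta>}"

text \<open>
  The distance is extended-valued: it is infinite if every coupling has infinite cost, so that
  convergence to \<open>0\<close> cannot hold because of \<open>enn2real \<top> = 0\<close>.
\<close>

definition wasserstein :: "real \<Rightarrow> real measure \<Rightarrow> real measure \<Rightarrow> ennreal" where
  "wasserstein p \<eta> \<zeta> =
    (let C = (INF \<gamma>\<in>couplings \<eta> \<zeta>. \<integral>\<^sup>+(x, y). ennreal (\<bar>x - y\<bar> powr p) \<partial>\<gamma>)
     in if C = \<top> then \<top> else ennreal (enn2real C powr (1 / p)))"

end

theory Submission
  imports Defs "HOL-Real_Asymp.Real_Asymp"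
begin

text \<open>
  Given the sample, the conditional mean of \<open>\<xi>\<^sub>m\<^sup>*\<close> is a U-statistic of order \<open>m\<close> whose kernel
  is \<open>\<xi>\<^sub>m\<close> averaged over the tie-breaking. Writing it as an average over all permutations
  of averages over \<open>n div m\<close> disjoint blocks (Hoeffding) bounds its variance by
  \<open>Var \<xi>\<^sub>m / (n div m)\<close>. Unconditionally \<open>\<xi>\<^sub>m\<^sup>*\<close> has the law of \<open>\<xi>\<^sub>m\<close>, so the bootstrap statistic
  differs from a copy of \<open>T\<^sub>m\<close> by an error whose second moment is at most
  \<open>E T\<^sub>m\<^sup>2 / (n div m)\<close>. This tends to 0 when \<open>m = o(n)\<close>, hence under either condition.
  Uniform square-integrability turns the weak convergence of \<open>T\<^sub>m\<close> into convergence of second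
  moments as well, and weak convergence together with convergence of second moments gives
  convergence in \<open>d\<^sub>2\<close> along a Skorohod coupling.
\<close>

section \<open>Weak convergence and the Wasserstein distance\<close>

text \<open>The bootstrap statistic is centred at a random conditional mean, so it is not itself a
  copy of \<open>T_stat\<close>. Replacing that centre by the constant mean of
  \<open>xi_stat\<close> at size m gives an exact copy in law, and since the distance sees only
  laws, this copy may depend on the sample and the resample in any way. The replacement costs sqrt m
  times the error of a U-statistic. In the second moment the factor m is absorbed by E T_m^2 = m Var
  xi_m, which converges, so the number of disjoint blocks alone produces the decay. The draws
  overlap and their kernel values are dependent; convexity of the square, applied to the average
  over permutations, replaces any counting of covariances between overlapping draws. Random lists
  are handled through finite averages: a uniform choice independent of the data is resolved by
  summing over its values. Carrying a test function \<open>h\<close> and a weight \<open>a\<close>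
  through this sum makes one formula yield laws, moments and the conditional expectation.\<close>

text \<open>The joint law of \<open>(U, V)\<close> is one admissible coupling, and its cost bounds
  the infimum.\<close>

lemma wasserstein_2_le:
  assumes "prob_space P" and [measurable]: "U \<in> borel_measurable P" "V \<in> borel_measurable P"
    and int: "integrable P (\<lambda>x. (U x - V x)\<^sup>2)"
  shows "wasserstein 2 (distr P borel U) (distr P borel V)
    \<le> ennreal (sqrt (LINT x|P. (U x - V x)\<^sup>2))"
proof -
  interpret P: prob_space P by fact
  define \<gamma> where "\<gamma> = distr P (borel :: (real \<times> real) measure) (\<lambda>x. (U x, V x))"
  define C where "C = (INF \<gamma>\<in>couplings (distr P borel U) (distr P borel V).
    \<integral>\<^sup>+(x, y). ennreal (\<bar>x - y\<bar> powr 2) \<partial>\<gamma>)"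
  let ?b = "LINT x|P. (U x - V x)\<^sup>2"
  have pair [measurable]: "(\<lambda>x. (U x, V x)) \<in> measurable P borel"
    by (simp add: borel_prod[symmetric])
  have fst_snd: "fst \<in> measurable (borel :: (real \<times> real) measure) borel"
    "snd \<in> measurable (borel :: (real \<times> real) measure) borel"
    by (simp_all add: borel_prod[symmetric])
  have "\<gamma> \<in> couplings (distr P borel U) (distr P borel V)"
    unfolding couplings_def \<gamma>_def
    by (auto simp: P.prob_space_distr distr_distr fst_snd comp_def)
  then have "C \<le> (\<integral>\<^sup>+(x, y). ennreal (\<bar>x - y\<bar> powr 2) \<partial>\<gamma>)"
    unfolding C_def by (rule INF_lower)
  also have "\<dots> = (\<integral>\<^sup>+x. ennreal ((U x - V x)\<^sup>2) \<partial>P)"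
    unfolding \<gamma>_def by (subst nn_integral_distr) (auto simp: borel_prod[symmetric] powr_numeral)
  also have "\<dots> = ennreal ?b"
    by (rule nn_integral_eq_integral[OF int]) auto
  finally have C: "C \<le> ennreal ?b" .
  \<comment> \<open>A finite cost excludes the infinite branch of
    \<open>wasserstein\<close>.\<close>
  then have top: "C \<noteq> \<top>"
    by (metis ennreal_neq_top top_unique)
  have "enn2real C \<le> ?b"
    using enn2real_mono[OF C] by simp
  then have "enn2real C powr (1 / 2) \<le> sqrt ?b"
    by (subst powr_half_sqrt[symmetric]) (auto intro!: powr_mono2)
  then show ?thesis
    unfolding wasserstein_def Let_def C_def[symmetric] if_not_P[OF top] by (rule ennreal_leI)
qed

lemma integrable_mult_of_square_integrable:
  fixes f g :: "'a \<Rightarrow> real"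
  assumes [measurable]: "f \<in> borel_measurable M" "g \<in> borel_measurable M"
    and "integrable M (\<lambda>x. (f x)\<^sup>2)" "integrable M (\<lambda>x. (g x)\<^sup>2)"
  shows "integrable M (\<lambda>x. f x * g x)"
proof (rule Bochner_Integration.integrable_bound)
  show "integrable M (\<lambda>x. (f x)\<^sup>2 + (g x)\<^sup>2)" using assms by simp
  have "\<bar>f x * g x\<bar> \<le> (f x)\<^sup>2 + (g x)\<^sup>2" for x
    using sum_squares_bound[of "\<bar>f x\<bar>" "\<bar>g x\<bar>"] abs_ge_zero[of "f x * g x"]
    unfolding abs_mult by (simp only: power2_abs mult.assoc)
  then show "AE x in M. norm (f x * g x) \<le> norm ((f x)\<^sup>2 + (g x)\<^sup>2)" by simp
qed measurable

text \<open>The integral of \<open>(f + t g)^2\<close> is a quadratic in \<open>t\<close> that is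
  never negative; a suitable \<open>t\<close> gives the inequality.\<close>

lemma Cauchy_Schwarz_integral:
  fixes f g :: "'a \<Rightarrow> real"
  assumes [measurable]: "f \<in> borel_measurable M" "g \<in> borel_measurable M"
    and f: "integrable M (\<lambda>x. (f x)\<^sup>2)" and g: "integrable M (\<lambda>x. (g x)\<^sup>2)"
  shows "(LINT x|M. f x * g x)\<^sup>2 \<le> (LINT x|M. (f x)\<^sup>2) * (LINT x|M. (g x)\<^sup>2)"
proof -
  define a b p where "a = (LINT x|M. (f x)\<^sup>2)" and "b = (LINT x|M. (g x)\<^sup>2)"
    and "p = (LINT x|M. f x * g x)"
  have fg: "integrable M (\<lambda>x. f x * g x)"
    by (rule integrable_mult_of_square_integrable) fact+
  have quad: "0 \<le> a + 2 * t * p + t\<^sup>2 * b" for t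
  proof -
    have "0 \<le> (LINT x|M. (f x + t * g x)\<^sup>2)" by simp
    also have "\<dots> = (LINT x|M. (f x)\<^sup>2 + 2 * t * (f x * g x) + t\<^sup>2 * (g x)\<^sup>2)"
      by (intro Bochner_Integration.integral_cong) (auto simp: power2_eq_square algebra_simps)
    also have "\<dots> = a + 2 * t * p + t\<^sup>2 * b"
      using f g fg by (simp add: a_def b_def p_def)
    finally show ?thesis .
  qed
  have b: "0 \<le> b" by (simp add: b_def)
  have "p\<^sup>2 \<le> a * b"
  proof (cases "b = 0")
    case True
    have "p = 0"
    proof (rule ccontr)
      assume "p \<noteq> 0"
      \<comment> \<open>This \<open>t\<close> makes the linear expression \<open>a + 2 t p\<close>
        equal to -1.\<close>
      then show False
        using quad[of "- (a + 1) / (2 * p)"] True by (simp add: field_simps)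
    qed
    with True show ?thesis by simp
  next
    case False
    with b have "0 < b" by simp
    \<comment> \<open>The minimiser of the quadratic is \<open>t = - p / b\<close>.\<close>
    have "0 \<le> a - p\<^sup>2 / b"
      using quad[of "- p / b"] False by (simp add: power2_eq_square field_simps)
    with \<open>0 < b\<close> show ?thesis by (simp add: field_simps)
  qed
  then show ?thesis by (simp add: a_def b_def p_def)
qed

text \<open>On the Skorohod space the variables converge pointwise and their L2 norms converge to
  the norm of the limit. By a Riesz-Scheffe argument this forces convergence in L2, and the Skorohod
  pair serves as the coupling.\<close>

theorem wasserstein_2_tendsto_0:
  assumes rd: "\<And>n. real_distribution (\<mu> n)" "real_distribution \<nu>"
    and weak: "weak_conv_m \<mu> \<nu>"
    and int: "\<And>n. integrable (\<mu> n) (\<lambda>x. x\<^sup>2)" "integrable \<nu> (\<lambda>x. x\<^sup>2)"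
    and lim: "(\<lambda>n. LINT x|\<mu> n. x\<^sup>2) \<longlonglongrightarrow> (LINT x|\<nu>. x\<^sup>2)"
  shows "(\<lambda>n. wasserstein 2 (\<mu> n) \<nu>) \<longlonglongrightarrow> 0"
proof -
  from Skorohod[OF rd weak] obtain P :: "real measure" and Y' Y where P: "prob_space P"
    and Y' [measurable]: "\<And>n. Y' n \<in> borel_measurable P" and dY': "\<And>n. distr P borel (Y' n) = \<mu> n"
    and "Y \<in> measurable P lborel" and dY: "distr P borel Y = \<nu>"
    and conv: "\<And>x. x \<in> space P \<Longrightarrow> (\<lambda>n. Y' n x) \<longlonglongrightarrow> Y x"
    by blast
  then have Y [measurable]: "Y \<in> borel_measurable P" by simp
  have iY' [simp]: "integrable P (\<lambda>x. (Y' n x)\<^sup>2)" for n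
    using int(1)[of n] unfolding dY'[symmetric] by (simp add: integrable_distr_eq)
  have iY [simp]: "integrable P (\<lambda>x. (Y x)\<^sup>2)"
    using int(2) unfolding dY[symmetric] by (simp add: integrable_distr_eq)
  define v where "v = (LINT x|P. (Y x)\<^sup>2)"
  define b where "b n = (LINT x|P. (Y' n x - Y x)\<^sup>2)" for n
  have lim': "(\<lambda>n. LINT x|P. (Y' n x)\<^sup>2) \<longlonglongrightarrow> v"
    using lim unfolding dY'[symmetric] dY[symmetric] v_def by (simp add: integral_distr)
  have iprod: "integrable P (\<lambda>x. Y' n x * Y x)" for n
    by (rule integrable_mult_of_square_integrable) auto
  have idiff: "integrable P (\<lambda>x. (Y' n x - Y x)\<^sup>2)" for n
    unfolding power2_diff mult.assoc
    by (intro Bochner_Integration.integrable_diff Bochner_Integration.integrable_add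
      integrable_mult_right iY' iY iprod)
  have isum: "integrable P (\<lambda>x. (Y' n x + Y x)\<^sup>2)" for n
    unfolding power2_sum mult.assoc
    by (intro Bochner_Integration.integrable_add integrable_mult_right iY' iY iprod)
  \<comment> \<open>A Fatou-type argument: \<open>(Y' n + Y)\<^sup>2\<close> is \<open>2 (Y' n)\<^sup>2 + 2 Y\<^sup>2 - (Y' n - Y)\<^sup>2\<close>, and its truncation \<open>h\<close> has a dominated limit.\<close>
  define h where "h n x = min ((Y' n x + Y x)\<^sup>2) ((2 * Y x)\<^sup>2)" for n x
  have [measurable]: "h n \<in> borel_measurable P" for n
    unfolding h_def by measurable
  have "(\<lambda>n. LINT x|P. h n x) \<longlonglongrightarrow> (LINT x|P. (2 * Y x)\<^sup>2)"
  proof (rule integral_dominated_convergence[where w = "\<lambda>x. (2 * Y x)\<^sup>2"])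
    show "AE x in P. (\<lambda>n. h n x) \<longlonglongrightarrow> (2 * Y x)\<^sup>2"
    proof (rule AE_I2)
      fix x assume "x \<in> space P"
      then have "(\<lambda>n. h n x) \<longlonglongrightarrow> min ((Y x + Y x)\<^sup>2) ((2 * Y x)\<^sup>2)"
        unfolding h_def by (intro tendsto_min tendsto_power tendsto_add tendsto_const conv)
      then show "(\<lambda>n. h n x) \<longlonglongrightarrow> (2 * Y x)\<^sup>2" unfolding mult_2 min.idem .
    qed
  next
    show "integrable P (\<lambda>x. (2 * Y x)\<^sup>2)" unfolding power_mult_distrib by simp
    show "AE x in P. norm (h n x) \<le> (2 * Y x)\<^sup>2" for n by (simp add: h_def)
  qed measurable
  then have lim_h: "(\<lambda>n. LINT x|P. h n x) \<longlonglongrightarrow> 4 * v"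
    by (simp add: power_mult_distrib v_def)
  have b_le: "b n \<le> 2 * (LINT x|P. (Y' n x)\<^sup>2) + 2 * v - (LINT x|P. h n x)" for n
  proof -
    have "(LINT x|P. h n x) \<le> (LINT x|P. (Y' n x + Y x)\<^sup>2)"
      using isum[of n] by (intro integral_mono Bochner_Integration.integrable_bound[OF isum[of n]])
        (auto simp: h_def)
    also have "\<dots> = (LINT x|P. (2 * (Y' n x)\<^sup>2 + 2 * (Y x)\<^sup>2) - (Y' n x - Y x)\<^sup>2)"
      by (intro Bochner_Integration.integral_cong) (auto simp: power2_eq_square algebra_simps)
    also have "\<dots> = 2 * (LINT x|P. (Y' n x)\<^sup>2) + 2 * v - b n"
      using idiff[of n] by (simp add: b_def v_def)
    finally show ?thesis by simp
  qed
  have "(\<lambda>n. 2 * (LINT x|P. (Y' n x)\<^sup>2) + 2 * v - (LINT x|P. h n x)) \<longlonglongrightarrow> 2 * v + 2 * v - 4 * v"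
    by (intro tendsto_intros lim' lim_h)
  then have "(\<lambda>n. 2 * (LINT x|P. (Y' n x)\<^sup>2) + 2 * v - (LINT x|P. h n x)) \<longlonglongrightarrow> 0" by simp
  then have "b \<longlonglongrightarrow> 0"
    by (intro real_tendsto_sandwich[of "\<lambda>_. 0" b]) (auto simp: b_le, simp add: b_def)
  then have "(\<lambda>n. ennreal (sqrt (b n))) \<longlonglongrightarrow> ennreal (sqrt 0)"
    by (intro tendsto_ennrealI tendsto_real_sqrt)
  moreover have "wasserstein 2 (\<mu> n) \<nu> \<le> ennreal (sqrt (b n))" for n
    using wasserstein_2_le[OF P _ _ idiff[of n]] unfolding dY' dY b_def by simp
  ultimately show ?thesis
    by (intro tendsto_sandwich[of "\<lambda>_. 0" "\<lambda>n. wasserstein 2 (\<mu> n) \<nu>"]) auto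
qed

section \<open>Stability of weak limits and second moments; uniform integrability\<close>

text \<open>For \<open>a < b\<close> the function is an affine map of slope
  \<open>-1 / (b - a)\<close> clamped to [0, 1], and clamping does not increase distances.\<close>

lemma cts_step_lipschitz:
  assumes "a < b"
  shows "\<bar>cts_step a b x - cts_step a b y\<bar> \<le> \<bar>x - y\<bar> / (b - a)"
proof -
  have *: "cts_step a b z = min 1 (max 0 ((b - z) / (b - a)))" for z
    using assms by (auto simp: cts_step_def min_def max_def zero_le_divide_iff divide_less_0_iff)
  have "\<bar>cts_step a b x - cts_step a b y\<bar> \<le> \<bar>(b - x) / (b - a) - (b - y) / (b - a)\<bar>"
  proof -
    have "\<bar>min 1 (max 0 u) - min 1 (max 0 w)\<bar> \<le> \<bar>u - w\<bar>" for u w :: real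
      by (simp add: min_def max_def)
    then show ?thesis unfolding * .
  qed
  also have "(b - x) / (b - a) - (b - y) / (b - a) = (y - x) / (b - a)"
    by (simp add: diff_divide_distrib)
  finally show ?thesis
    using assms by (simp add: abs_minus_commute abs_of_pos)
qed

context prob_space
begin

text \<open>The bound is the nonnegativity of the variance of the absolute value.\<close>

lemma expectation_abs_le_sqrt:
  fixes X :: "'a \<Rightarrow> real"
  assumes "integrable M (\<lambda>x. (X x)\<^sup>2)" and [measurable]: "X \<in> borel_measurable M"
  shows "integrable M X" "expectation (\<lambda>x. \<bar>X x\<bar>) \<le> sqrt (expectation (\<lambda>x. (X x)\<^sup>2))"
proof -
  show i: "integrable M X" by (rule square_integrable_imp_integrable) fact+
  have "0 \<le> variance (\<lambda>x. \<bar>X x\<bar>)" by (rule variance_positive)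
  also have "\<dots> = expectation (\<lambda>x. (X x)\<^sup>2) - (expectation (\<lambda>x. \<bar>X x\<bar>))\<^sup>2"
    using assms i by (subst variance_eq) auto
  finally show "expectation (\<lambda>x. \<bar>X x\<bar>) \<le> sqrt (expectation (\<lambda>x. (X x)\<^sup>2))"
    by (intro real_le_rsqrt) auto
qed

text \<open>Convergence of the integrals of all functions \<open>cts_step a b\<close> already
  implies weak convergence. These are Lipschitz, so a perturbation changes their integrals by at
  most its L1 norm over \<open>b - a\<close>, hence by at most its L2 norm over
  \<open>b - a\<close>.\<close>

lemma weak_conv_m_L2_perturbation:
  fixes X Z :: "nat \<Rightarrow> 'a \<Rightarrow> real"
  assumes [measurable]: "\<And>n. X n \<in> borel_measurable M" "\<And>n. Z n \<in> borel_measurable M"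
    and \<nu>: "real_distribution \<nu>"
    and weak: "weak_conv_m (\<lambda>n. distr M borel (X n)) \<nu>"
    and int: "\<And>n. integrable M (\<lambda>x. (Z n x - X n x)\<^sup>2)"
    and lim: "(\<lambda>n. expectation (\<lambda>x. (Z n x - X n x)\<^sup>2)) \<longlonglongrightarrow> 0"
  shows "weak_conv_m (\<lambda>n. distr M borel (Z n)) \<nu>"
proof (rule integral_cts_step_conv_imp_weak_conv)
  fix a b :: real assume ab: "a < b"
  have [measurable]: "cts_step a b \<in> borel_measurable borel"
    unfolding cts_step_def by measurable
  have icts: "integrable M (\<lambda>x. cts_step a b (W x))" if [measurable]: "W \<in> borel_measurable M" for W
    by (rule integrable_const_bound[where B = 1]) (use ab in \<open>auto simp: cts_step_def divide_simps\<close>)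
  have X: "(\<lambda>n. expectation (\<lambda>x. cts_step a b (X n x))) \<longlonglongrightarrow> integral\<^sup>L \<nu> (cts_step a b)"
  proof -
    have "(\<lambda>n. integral\<^sup>L (distr M borel (X n)) (cts_step a b)) \<longlonglongrightarrow> integral\<^sup>L \<nu> (cts_step a b)"
    proof (rule weak_conv_imp_integral_bdd_continuous_conv[OF _ \<nu> weak, where B = 1])
      show "isCont (cts_step a b) x" for x
        using uniformly_continuous_imp_continuous[OF cts_step_uniformly_continuous[OF ab]]
        by (auto intro: continuous_on_interior)
    qed (use ab in \<open>auto simp: cts_step_def divide_simps\<close>)
    then show ?thesis by (simp add: integral_distr)
  qed
  have bound: "norm (expectation (\<lambda>x. cts_step a b (Z n x)) - expectation (\<lambda>x. cts_step a b (X n x)))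
      \<le> sqrt (expectation (\<lambda>x. (Z n x - X n x)\<^sup>2)) / (b - a)" for n
  proof -
    have i: "integrable M (\<lambda>x. Z n x - X n x)"
      by (rule expectation_abs_le_sqrt[OF int]) simp
    have "norm (expectation (\<lambda>x. cts_step a b (Z n x)) - expectation (\<lambda>x. cts_step a b (X n x)))
        = norm (expectation (\<lambda>x. cts_step a b (Z n x) - cts_step a b (X n x)))"
      by (simp add: icts)
    also have "\<dots> \<le> expectation (\<lambda>x. \<bar>cts_step a b (Z n x) - cts_step a b (X n x)\<bar>)"
      using integral_norm_bound[of M "\<lambda>x. cts_step a b (Z n x) - cts_step a b (X n x)"] by simp
    also have "\<dots> \<le> expectation (\<lambda>x. \<bar>Z n x - X n x\<bar> / (b - a))"
      using i by (intro integral_mono cts_step_lipschitz ab integrable_abs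
        Bochner_Integration.integrable_diff icts) auto
    also have "\<dots> \<le> sqrt (expectation (\<lambda>x. (Z n x - X n x)\<^sup>2)) / (b - a)"
      using expectation_abs_le_sqrt(2)[OF int] ab by (simp add: divide_right_mono)
    finally show ?thesis .
  qed
  have "(\<lambda>n. sqrt (expectation (\<lambda>x. (Z n x - X n x)\<^sup>2)) / (b - a)) \<longlonglongrightarrow> 0"
    using tendsto_divide[OF tendsto_real_sqrt[OF lim] tendsto_const, of "b - a"] ab by simp
  then have "(\<lambda>n. expectation (\<lambda>x. cts_step a b (Z n x))
      - expectation (\<lambda>x. cts_step a b (X n x))) \<longlonglongrightarrow> 0"
    by (rule Lim_null_comparison[OF always_eventually[OF allI[OF bound]]])
  from tendsto_add[OF this X] 
  show "(\<lambda>n. integral\<^sup>L (distr M borel (Z n)) (cts_step a b)) \<longlonglongrightarrow> integral\<^sup>L \<nu> (cts_step a b)"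
    by (simp add: integral_distr)
qed (simp_all add: \<nu>)

text \<open>In the expanded square the cross term is controlled by Cauchy-Schwarz: it is at most the
  root of a convergent factor times one that tends to 0.\<close>

lemma second_moment_L2_perturbation:
  fixes X Z :: "nat \<Rightarrow> 'a \<Rightarrow> real"
  assumes [measurable]: "\<And>n. X n \<in> borel_measurable M" "\<And>n. Z n \<in> borel_measurable M"
    and intX: "\<And>n. integrable M (\<lambda>x. (X n x)\<^sup>2)"
    and limX: "(\<lambda>n. expectation (\<lambda>x. (X n x)\<^sup>2)) \<longlonglongrightarrow> v"
    and int: "\<And>n. integrable M (\<lambda>x. (Z n x - X n x)\<^sup>2)"
    and lim: "(\<lambda>n. expectation (\<lambda>x. (Z n x - X n x)\<^sup>2)) \<longlonglongrightarrow> 0"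
  shows "\<And>n. integrable M (\<lambda>x. (Z n x)\<^sup>2)" "(\<lambda>n. expectation (\<lambda>x. (Z n x)\<^sup>2)) \<longlonglongrightarrow> v"
proof -
  define D where "D n x = Z n x - X n x" for n x
  define e where "e n = expectation (\<lambda>x. (D n x)\<^sup>2)" for n
  define p where "p n = expectation (\<lambda>x. X n x * D n x)" for n
  have [measurable]: "D n \<in> borel_measurable M" for n unfolding D_def by measurable
  have iD: "integrable M (\<lambda>x. (D n x)\<^sup>2)" for n using int by (simp add: D_def)
  have iprod: "integrable M (\<lambda>x. X n x * D n x)" for n
    by (rule integrable_mult_of_square_integrable) (use intX iD in auto)
  have Z2: "(Z n x)\<^sup>2 = (X n x)\<^sup>2 + 2 * (X n x * D n x) + (D n x)\<^sup>2" for n x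
    by (simp add: D_def power2_eq_square algebra_simps)
  show "integrable M (\<lambda>x. (Z n x)\<^sup>2)" for n
    unfolding Z2 using intX iD iprod by simp
  have p: "norm (p n) \<le> sqrt (expectation (\<lambda>x. (X n x)\<^sup>2) * e n)" for n
    using Cauchy_Schwarz_integral[of "X n" M "D n"] intX iD
    unfolding p_def e_def real_norm_def by (intro real_le_rsqrt) auto
  have "(\<lambda>n. sqrt (expectation (\<lambda>x. (X n x)\<^sup>2) * e n)) \<longlonglongrightarrow> sqrt (v * 0)"
    using lim by (intro tendsto_real_sqrt tendsto_mult limX) (simp add: e_def D_def)
  then have "p \<longlonglongrightarrow> 0"
    unfolding mult_zero_right real_sqrt_zero
    by (rule Lim_null_comparison[OF always_eventually[OF allI[OF p]]])
  then have "(\<lambda>n. expectation (\<lambda>x. (X n x)\<^sup>2) + 2 * p n + e n) \<longlonglongrightarrow> v + 2 * 0 + 0"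
    using lim by (intro tendsto_add tendsto_mult tendsto_const limX) (simp_all add: e_def D_def)
  moreover have "expectation (\<lambda>x. (Z n x)\<^sup>2) = expectation (\<lambda>x. (X n x)\<^sup>2) + 2 * p n + e n" for n
    unfolding Z2 using intX iD iprod by (simp add: p_def e_def)
  ultimately show "(\<lambda>n. expectation (\<lambda>x. (Z n x)\<^sup>2)) \<longlonglongrightarrow> v" by simp
qed

text \<open>The square is truncated at a level \<open>L\<close>. Weak convergence applies to the
  truncated square, which is bounded and continuous; the truncation errors are small uniformly in
  \<open>n\<close> by uniform integrability, and under the limit by integrability. Indices below
  \<open>N\<close> do not affect the limit.\<close>

lemma second_moment_of_uniformly_square_integrable:
  fixes X :: "nat \<Rightarrow> 'a \<Rightarrow> real"
  assumes [measurable]: "\<And>n. X n \<in> borel_measurable M"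
    and usi: "uniformly_square_integrable M {N..} X"
    and \<nu>: "real_distribution \<nu>"
    and weak: "weak_conv_m (\<lambda>n. distr M borel (X n)) \<nu>"
    and int: "integrable \<nu> (\<lambda>x. x\<^sup>2)"
  shows "(\<lambda>n. expectation (\<lambda>x. (X n x)\<^sup>2)) \<longlonglongrightarrow> (LINT x|\<nu>. x\<^sup>2)"
proof (rule LIMSEQ_I)
  fix e :: real assume "0 < e"
  interpret \<nu>: real_distribution \<nu> by fact
  have intX: "integrable M (\<lambda>x. (X n x)\<^sup>2)" if "N \<le> n" for n
    using usi that by (auto simp: uniformly_square_integrable_def uniformly_integrable_def)
  have "\<exists>K. \<forall>n\<in>{N..}. (LINT x|M. \<bar>(X n x)\<^sup>2\<bar> * indicator {x. K < \<bar>(X n x)\<^sup>2\<bar>} x) \<le> e / 4"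
    using usi \<open>0 < e\<close> unfolding uniformly_square_integrable_def uniformly_integrable_def
    by (elim conjE allE[of _ "e / 4"]) simp
  then obtain K where
    K: "\<And>n. N \<le> n \<Longrightarrow> (LINT x|M. (X n x)\<^sup>2 * indicator {x. K < (X n x)\<^sup>2} x) \<le> e / 4"
    by auto
  have "(\<lambda>j. LINT x|\<nu>. min (x\<^sup>2) (real j)) \<longlonglongrightarrow> (LINT x|\<nu>. x\<^sup>2)"
  proof (rule integral_dominated_convergence[where w = "\<lambda>x. x\<^sup>2"])
    show "AE x in \<nu>. (\<lambda>j. min (x\<^sup>2) (real j)) \<longlonglongrightarrow> x\<^sup>2"
    proof (rule AE_I2, rule tendsto_eventually)
      fix x :: real
      obtain j0 where "x\<^sup>2 \<le> real j0" using real_arch_simple by blast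
      then show "\<forall>\<^sub>F j in sequentially. min (x\<^sup>2) (real j) = x\<^sup>2"
        by (intro eventually_sequentiallyI[of j0]) (simp add: min_def)
    qed
  qed (auto intro: int)
  from LIMSEQ_D[OF this, of "e / 4"] \<open>0 < e\<close> obtain J
    where J: "\<And>j. J \<le> j \<Longrightarrow> norm ((LINT x|\<nu>. min (x\<^sup>2) (real j)) - (LINT x|\<nu>. x\<^sup>2)) < e / 4"
    by auto
  obtain j1 where "K \<le> real j1" using real_arch_simple by blast
  \<comment> \<open>One level serves both truncations: \<open>J\<close> makes the tail under the
    limit law small, and \<open>j1\<close> puts the level above the threshold \<open>K\<close> of
    uniform integrability.\<close>
  define L where "L = real (max J j1)"
  have KL: "K \<le> L" "0 \<le> L" using \<open>K \<le> real j1\<close> by (auto simp: L_def)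
  define f where "f x = min (x\<^sup>2) L" for x :: real
  have [measurable]: "f \<in> borel_measurable borel" unfolding f_def by measurable
  have "(\<lambda>n. integral\<^sup>L (distr M borel (X n)) f) \<longlonglongrightarrow> integral\<^sup>L \<nu> f"
    by (rule weak_conv_imp_integral_bdd_continuous_conv[OF _ \<nu> weak, where B = L])
      (auto simp: f_def[abs_def] KL intro!: continuous_intros)
  then have "(\<lambda>n. expectation (\<lambda>x. f (X n x))) \<longlonglongrightarrow> integral\<^sup>L \<nu> f"
    by (simp add: integral_distr)
  from LIMSEQ_D[OF this, of "e / 4"] \<open>0 < e\<close> obtain n0
    where n0: "\<And>n. n0 \<le> n \<Longrightarrow> norm (expectation (\<lambda>x. f (X n x)) - integral\<^sup>L \<nu> f) < e / 4"
    by auto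
  show "\<exists>no. \<forall>n\<ge>no. norm (expectation (\<lambda>x. (X n x)\<^sup>2) - (LINT x|\<nu>. x\<^sup>2)) < e"
  proof (intro exI[of _ "max N n0"] allI impI)
    fix n assume "max N n0 \<le> n"
    then have n: "N \<le> n" "n0 \<le> n" by auto
    have iX: "integrable M (\<lambda>x. (X n x)\<^sup>2)" by (rule intX) fact
    have if': "integrable M (\<lambda>x. f (X n x))"
      by (rule integrable_const_bound[where B = L]) (auto simp: f_def KL)
    have "expectation (\<lambda>x. (X n x)\<^sup>2) - expectation (\<lambda>x. f (X n x))
        = expectation (\<lambda>x. (X n x)\<^sup>2 - f (X n x))"
      using iX if' by simp
    \<comment> \<open>Where truncation changes the square, the square exceeds \<open>L\<close> and
      therefore \<open>K\<close>.\<close>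
    also have "\<dots> \<le> expectation (\<lambda>x. (X n x)\<^sup>2 * indicator {x. K < (X n x)\<^sup>2} x)"
      using KL
      by (intro integral_mono Bochner_Integration.integrable_diff iX if'
        Bochner_Integration.integrable_bound[OF iX]) (auto simp: f_def indicator_def)
    also have "\<dots> \<le> e / 4" by (rule K) fact
    finally have 1: "expectation (\<lambda>x. (X n x)\<^sup>2) - expectation (\<lambda>x. f (X n x)) \<le> e / 4" .
    have 2: "expectation (\<lambda>x. f (X n x)) \<le> expectation (\<lambda>x. (X n x)\<^sup>2)"
      using iX if' by (intro integral_mono) (auto simp: f_def)
    have 3: "norm (integral\<^sup>L \<nu> f - (LINT x|\<nu>. x\<^sup>2)) < e / 4"
      using J[of "max J j1"] by (simp add: f_def[abs_def] L_def)
    show "norm (expectation (\<lambda>x. (X n x)\<^sup>2) - (LINT x|\<nu>. x\<^sup>2)) < e"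
      using 1 2 3 n0[OF n(2)] \<open>0 < e\<close> unfolding real_norm_def by linarith
  qed
qed

end

section \<open>Variance of U-statistics\<close>

lemma finite_draws: "finite (draws m n)"
proof (rule finite_subset)
  show "draws m n \<subseteq> {l. set l \<subseteq> {..<n} \<and> length l = m}" by (auto simp: draws_def)
qed (simp add: finite_lists_length_eq)

lemma upt_in_draws: "m \<le> n \<Longrightarrow> [0..<m] \<in> draws m n"
  by (auto simp: draws_def)

lemma draws_nonempty: "m \<le> n \<Longrightarrow> draws m n \<noteq> {}"
  using upt_in_draws by blast

lemma map_permutes_in_draws:
  assumes "\<sigma> permutes {..<n}" "l \<in> draws m n"
  shows "map \<sigma> l \<in> draws m n"
proof -
  have "inj_on \<sigma> (set l)" using permutes_inj_on[OF assms(1)] .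
  then show ?thesis
    using assms(2) permutes_in_image[OF assms(1)] by (auto simp: draws_def distinct_map)
qed

text \<open>Matching positions gives a bijection between the entries of the two lists. The
  complements in \<open>{..<n}\<close> have equal cardinality, so any bijection between them
  completes it to a permutation.\<close>

lemma ex_permutes_map_eq:
  assumes "l \<in> draws m n" "l' \<in> draws m n"
  shows "\<exists>\<tau>. \<tau> permutes {..<n} \<and> map \<tau> l = l'"
proof -
  have l: "distinct l" "set l \<subseteq> {..<n}" "length l = m"
    and l': "distinct l'" "set l' \<subseteq> {..<n}" "length l' = m"
    using assms by (auto simp: draws_def)
  define f where "f x = l' ! (the_inv_into {..<m} ((!) l) x)" for x
  have bl: "bij_betw ((!) l) {..<m} (set l)" "bij_betw ((!) l') {..<m} (set l')"
    using l l' by (auto intro!: bij_betw_nth)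
  have f: "bij_betw f (set l) (set l')"
    unfolding f_def[abs_def]
    using bij_betw_trans[OF bij_betw_the_inv_into[OF bl(1)] bl(2)] by (simp add: comp_def)
  have f_nth: "f (l ! i) = l' ! i" if "i < m" for i
    using that bl(1) by (simp add: f_def bij_betw_def the_inv_into_f_f)
  have "card ({..<n} - set l) = card ({..<n} - set l')"
    using l l' by (simp add: card_Diff_subset distinct_card)
  then obtain h where h: "bij_betw h ({..<n} - set l) ({..<n} - set l')"
    using finite_same_card_bij[of "{..<n} - set l" "{..<n} - set l'"] by auto
  define \<tau> where "\<tau> x = (if x \<in> set l then f x else if x \<in> {..<n} then h x else x)" for x
  have "bij_betw \<tau> (set l \<union> ({..<n} - set l)) (set l' \<union> ({..<n} - set l'))"
  proof (rule bij_betw_combine)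
    show "bij_betw \<tau> (set l) (set l')"
      using f by (subst bij_betw_cong[of _ _ f]) (auto simp: \<tau>_def)
    show "bij_betw \<tau> ({..<n} - set l) ({..<n} - set l')"
      using h by (subst bij_betw_cong[of _ _ h]) (auto simp: \<tau>_def)
  qed auto
  then have "bij_betw \<tau> {..<n} {..<n}"
    using l(2) l'(2) by (simp add: Un_absorb1)
  then have "\<tau> permutes {..<n}"
    using l(2) by (intro bij_imp_permutes) (auto simp: \<tau>_def)
  moreover have "map \<tau> l = l'"
    using l l' f_nth by (intro nth_equalityI) (auto simp: \<tau>_def)
  ultimately show ?thesis by blast
qed

text \<open>
  The permutations act transitively on the draws, so the left-hand side does not depend on \<open>l\<close>;
  averaging it over \<open>l\<close> gives the right-hand side.
\<close>

lemma sum_permutes_draw: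
  fixes f :: "nat list \<Rightarrow> real"
  assumes l: "l \<in> draws m n"
  shows "(\<Sum>\<sigma> | \<sigma> permutes {..<n}. f (map \<sigma> l)) / fact n
    = (\<Sum>l'\<in>draws m n. f l') / card (draws m n)"
proof -
  define F where "F l = (\<Sum>\<sigma> | \<sigma> permutes {..<n}. f (map \<sigma> l))" for l
  have const: "F l' = F l" if l': "l' \<in> draws m n" for l'
  proof -
    obtain \<tau> where \<tau>: "\<tau> permutes {..<n}" "map \<tau> l = l'"
      using ex_permutes_map_eq[OF l l'] by blast
    \<comment> \<open>The sum over all permutations is unchanged when \<sigma> is replaced by
      \<sigma> composed with \<tau>.\<close>
    show ?thesis
      unfolding F_def by (subst (2) sum_permutations_compose_right[OF \<tau>(1)]) (simp flip: \<tau>(2))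
  qed
  have inner: "(\<Sum>l'\<in>draws m n. f (map \<sigma> l')) = (\<Sum>l'\<in>draws m n. f l')"
    if \<sigma>: "\<sigma> permutes {..<n}" for \<sigma>
    by (rule sum.reindex_bij_witness[where i = "map (inv \<sigma>)" and j = "map \<sigma>"])
      (use \<sigma> permutes_inv[OF \<sigma>] in
        \<open>auto simp: map_permutes_in_draws permutes_inv_o comp_def permutes_inverses\<close>)
  have "card (draws m n) * F l = (\<Sum>l'\<in>draws m n. F l')"
    by (simp add: const)
  also have "\<dots> = (\<Sum>\<sigma> | \<sigma> permutes {..<n}. \<Sum>l'\<in>draws m n. f (map \<sigma> l'))"
    unfolding F_def by (rule sum.swap)
  also have "\<dots> = fact n * (\<Sum>l'\<in>draws m n. f l')"
    by (simp add: inner card_permutations[of "{..<n}" n])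
  finally show ?thesis
    using card_gt_0_iff[of "draws m n"] l finite_draws[of m n]
    by (auto simp: F_def divide_simps mult.commute)
qed

section \<open>Blocks of an iid sequence and Hoeffding's decomposition\<close>

locale iid_sequence = prob_space +
  fixes N :: "'b measure" and Z :: "nat \<Rightarrow> 'a \<Rightarrow> 'b"
  assumes indep: "indep_vars (\<lambda>_. N) Z UNIV"
    and ident: "\<And>k. distr M N (Z k) = distr M N (Z 0)"
begin

text \<open>Entries are indexed by position in \<open>l\<close>, not by their original index, so
  that blocks of equal length take values in the same product space and their laws can be compared.
  The restriction makes the value extensional, as elements of a product space must be.\<close>

definition block :: "nat list \<Rightarrow> 'a \<Rightarrow> nat \<Rightarrow> 'b" where
  "block l \<omega> = (\<lambda>j\<in>{..<length l}. Z (l ! j) \<omega>)"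

lemma Z_measurable [measurable]: "Z k \<in> measurable M N"
  using indep by (simp add: indep_vars_def)

lemma block_measurable [measurable]:
  "block l \<in> measurable M (Pi\<^sub>M {..<length l} (\<lambda>_. N))"
  unfolding block_def by measurable

text \<open>Distinct entries select different members of the sequence, which are independent with a
  common law. Hence the law depends on the length of \<open>l\<close> only.\<close>

lemma distr_block:
  assumes "distinct l" "l \<noteq> []"
  shows "distr M (Pi\<^sub>M {..<length l} (\<lambda>_. N)) (block l)
    = Pi\<^sub>M {..<length l} (\<lambda>_. distr M N (Z 0))"
proof -
  \<comment> \<open>Grouping the sequence into the singletons \<open>{l ! j}\<close> reindexes the
    independent family along the injective map \<open>j\<close> to \<open>l ! j\<close>.\<close>
  have "indep_vars (\<lambda>j. Pi\<^sub>M {l ! j} (\<lambda>_. N)) (\<lambda>j \<omega>. restrict (\<lambda>i. Z i \<omega>) {l ! j}) {..<length l}"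
    using assms
    by (intro indep_vars_restrict[OF indep]) (auto simp: disjoint_family_on_def nth_eq_iff_index_eq)
  then have "indep_vars (\<lambda>_. N) (\<lambda>j. (\<lambda>w. w (l ! j)) \<circ> (\<lambda>\<omega>. restrict (\<lambda>i. Z i \<omega>) {l ! j})) {..<length l}"
    by (rule indep_vars_compose) measurable
  then have "indep_vars (\<lambda>_. N) (\<lambda>j. Z (l ! j)) {..<length l}"
    by (simp add: comp_def)
  then have "distr M (Pi\<^sub>M {..<length l} (\<lambda>_. N)) (\<lambda>\<omega>. \<lambda>j\<in>{..<length l}. Z (l ! j) \<omega>)
    = Pi\<^sub>M {..<length l} (\<lambda>j. distr M N (Z (l ! j)))"
    using assms by (subst (asm) indep_vars_iff_distr_eq_PiM) auto
  also have "\<dots> = Pi\<^sub>M {..<length l} (\<lambda>_. distr M N (Z 0))"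
    by (intro PiM_cong refl ident)
  finally show ?thesis
    unfolding block_def[abs_def] .
qed

lemma distr_block_eq:
  assumes "distinct l" "distinct l'" "length l = length l'" "l \<noteq> []"
  shows "distr M (Pi\<^sub>M {..<length l'} (\<lambda>_. N)) (block l) = distr M (Pi\<^sub>M {..<length l'} (\<lambda>_. N)) (block l')"
  using distr_block[of l] distr_block[of l'] assms by force

lemma indep_blocks:
  assumes "set l \<inter> set l' = {}"
    and [measurable]: "f \<in> measurable (Pi\<^sub>M {..<length l} (\<lambda>_. N)) K"
      "g \<in> measurable (Pi\<^sub>M {..<length l'} (\<lambda>_. N)) K'"
  shows "indep_var K (\<lambda>\<omega>. f (block l \<omega>)) K' (\<lambda>\<omega>. g (block l' \<omega>))"
proof -
  have sel: "(\<lambda>w. \<lambda>j\<in>{..<length l}. w (l ! j)) \<in> measurable (Pi\<^sub>M (set l) (\<lambda>_. N)) (Pi\<^sub>M {..<length l} (\<lambda>_. N))"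
    for l :: "nat list"
    by (rule measurable_restrict) (simp add: measurable_component_singleton)
  have "indep_var K ((\<lambda>w. f (\<lambda>j\<in>{..<length l}. w (l ! j))) \<circ> (\<lambda>\<omega>. restrict (\<lambda>i. Z i \<omega>) (set l)))
    K' ((\<lambda>w. g (\<lambda>j\<in>{..<length l'}. w (l' ! j))) \<circ> (\<lambda>\<omega>. restrict (\<lambda>i. Z i \<omega>) (set l')))"
    by (rule indep_var_compose[OF indep_var_restrict[OF indep assms(1)]])
      (auto intro: measurable_compose[OF sel])
  then show ?thesis
    by (simp add: comp_def block_def cong: restrict_cong)
qed

text \<open>For a fixed permutation, \<open>V\<close> averages \<open>k\<close> independent centred
  variables of second moment \<open>v\<close>, so its second moment is \<open>v / k\<close>.
  \<open>U\<close> is the mean of all \<open>V\<close>, and by convexity its square is at most the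
  mean of their squares, however the \<open>V\<close> depend on each other.\<close>

theorem U_statistic_second_moment_le:
  assumes g [measurable]: "g \<in> borel_measurable (Pi\<^sub>M {..<m} (\<lambda>_. N))"
    and m: "0 < m" and k: "0 < k" "k * m \<le> n"
    and int: "integrable M (\<lambda>\<omega>. (g (block [0..<m] \<omega>))\<^sup>2)"
    and centred: "expectation (\<lambda>\<omega>. g (block [0..<m] \<omega>)) = 0"
  defines "U \<equiv> \<lambda>\<omega>. (\<Sum>l\<in>draws m n. g (block l \<omega>)) / card (draws m n)"
  shows "integrable M (\<lambda>\<omega>. (U \<omega>)\<^sup>2)"
    "expectation (\<lambda>\<omega>. (U \<omega>)\<^sup>2) \<le> expectation (\<lambda>\<omega>. (g (block [0..<m] \<omega>))\<^sup>2) / k"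
proof -
  define v where "v = expectation (\<lambda>\<omega>. (g (block [0..<m] \<omega>))\<^sup>2)"
  define G where "G l \<omega> = g (block l \<omega>)" for l \<omega>
  define B where "B i = [i * m..<Suc i * m]" for i
  define V where "V \<sigma> \<omega> = (\<Sum>i<k. G (map \<sigma> (B i)) \<omega>) / k" for \<sigma> \<omega>
  let ?P = "{\<sigma>. \<sigma> permutes {..<n}}"
  have [simp]: "finite ?P" by (simp add: finite_permutations)
  have cardP: "card ?P = fact n" by (simp add: card_permutations)
  have lenD: "length l = m" "distinct l" "l \<noteq> []" if "l \<in> draws m n" for l
    using that m by (auto simp: draws_def)
  have G_meas [measurable]: "G l \<in> borel_measurable M" if "l \<in> draws m n" for l
    using block_measurable[of l] lenD[OF that] unfolding G_def by simp
  have G_distr: "distr M (Pi\<^sub>M {..<m} (\<lambda>_. N)) (block l) = distr M (Pi\<^sub>M {..<m} (\<lambda>_. N)) (block [0..<m])"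
    if "l \<in> draws m n" for l
    using distr_block_eq[of l "[0..<m]"] lenD[OF that] by simp
  have bm: "block l \<in> measurable M (Pi\<^sub>M {..<m} (\<lambda>_. N))" if "length l = m" for l
    using block_measurable[of l] that by simp
  have G2: "integrable M (\<lambda>\<omega>. (G l \<omega>)\<^sup>2)" "expectation (\<lambda>\<omega>. (G l \<omega>)\<^sup>2) = v"
    and G1: "expectation (G l) = 0" if l: "l \<in> draws m n" for l
  proof -
    have b: "block l \<in> measurable M (Pi\<^sub>M {..<m} (\<lambda>_. N))"
      "block [0..<m] \<in> measurable M (Pi\<^sub>M {..<m} (\<lambda>_. N))"
      using lenD(1)[OF l] bm[of "[0..<m]"] by (simp_all add: bm)
    show "integrable M (\<lambda>\<omega>. (G l \<omega>)\<^sup>2)"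
      using int integrable_distr_eq[OF b(1), of "\<lambda>w. (g w)\<^sup>2"]
        integrable_distr_eq[OF b(2), of "\<lambda>w. (g w)\<^sup>2"] G_distr[OF l]
      by (simp add: G_def)
    show "expectation (\<lambda>\<omega>. (G l \<omega>)\<^sup>2) = v"
      using integral_distr[OF b(1), of "\<lambda>w. (g w)\<^sup>2"]
        integral_distr[OF b(2), of "\<lambda>w. (g w)\<^sup>2"] G_distr[OF l]
      by (simp add: G_def v_def)
    show "expectation (G l) = 0"
      using integral_distr[OF b(1) g] integral_distr[OF b(2) g] G_distr[OF l] centred
      by (simp add: G_def[abs_def])
  qed
  have intG: "integrable M (G l)" if "l \<in> draws m n" for l
    by (rule square_integrable_imp_integrable) (use that G_meas G2(1) in auto)
  have intGG: "integrable M (\<lambda>\<omega>. G l \<omega> * G l' \<omega>)" if "l \<in> draws m n" "l' \<in> draws m n" for l l'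
    by (rule integrable_mult_of_square_integrable) (use that G_meas G2(1) in auto)
  have B: "B i \<in> draws m n" if "i < k" for i
  proof -
    have "Suc i * m \<le> k * m" using that by (intro mult_right_mono) auto
    then show ?thesis using k(2) by (auto simp: B_def draws_def)
  qed
  have B_disj: "set (B i) \<inter> set (B j) = {}" if "i \<noteq> j" for i j
  proof -
    have "x div m = i" if "x \<in> set (B i)" for x i
      using that m by (intro div_nat_eqI) (auto simp: B_def mult.commute)
    with that show ?thesis by blast
  qed
  have \<sigma>B: "map \<sigma> (B i) \<in> draws m n" if "\<sigma> \<in> ?P" "i < k" for \<sigma> i
    using that by (simp add: map_permutes_in_draws B)
  have cov: "expectation (\<lambda>\<omega>. G (map \<sigma> (B i)) \<omega> * G (map \<sigma> (B j)) \<omega>) = (if i = j then v else 0)"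
    if \<sigma>: "\<sigma> \<in> ?P" and ij: "i < k" "j < k" for \<sigma> i j
  proof (cases "i = j")
    case True
    then show ?thesis using G2(2)[OF \<sigma>B[OF \<sigma> ij(1)]] by (simp add: power2_eq_square)
  next
    case False
    \<comment> \<open>A permutation is injective, so it keeps disjoint blocks disjoint; independence
      and centring then annihilate the covariance.\<close>
    have "set (map \<sigma> (B i)) \<inter> set (map \<sigma> (B j)) = {}"
      using B_disj[OF False] permutes_inj[of \<sigma> "{..<n}"] \<sigma> by (auto dest: injD)
    then have "indep_var borel (G (map \<sigma> (B i))) borel (G (map \<sigma> (B j)))"
      unfolding G_def[abs_def]
      using lenD(1)[OF \<sigma>B[OF \<sigma> ij(1)]] lenD(1)[OF \<sigma>B[OF \<sigma> ij(2)]]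
      by (intro indep_blocks) auto
    from indep_var_lebesgue_integral[OF this] show ?thesis
      using False \<sigma>B[OF \<sigma>] ij by (simp add: intG G1)
  qed
  have V_sq: "(V \<sigma> \<omega>)\<^sup>2 = (\<Sum>i<k. \<Sum>j<k. G (map \<sigma> (B i)) \<omega> * G (map \<sigma> (B j)) \<omega>) / (real k)\<^sup>2" for \<sigma> \<omega>
    by (simp add: V_def power_divide power2_eq_square sum_product)
  have V: "integrable M (\<lambda>\<omega>. (V \<sigma> \<omega>)\<^sup>2)" "expectation (\<lambda>\<omega>. (V \<sigma> \<omega>)\<^sup>2) = v / k"
    if "\<sigma> \<in> ?P" for \<sigma>
  proof -
    show "integrable M (\<lambda>\<omega>. (V \<sigma> \<omega>)\<^sup>2)"
      unfolding V_sq using \<sigma>B[OF that]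
      by (intro integrable_divide_zero Bochner_Integration.integrable_sum intGG) auto
    have "expectation (\<lambda>\<omega>. \<Sum>i<k. \<Sum>j<k. G (map \<sigma> (B i)) \<omega> * G (map \<sigma> (B j)) \<omega>)
        = (\<Sum>i<k. expectation (\<lambda>\<omega>. \<Sum>j<k. G (map \<sigma> (B i)) \<omega> * G (map \<sigma> (B j)) \<omega>))"
      using \<sigma>B[OF that]
      by (intro Bochner_Integration.integral_sum Bochner_Integration.integrable_sum intGG) auto
    also have "\<dots> = (\<Sum>i<k. \<Sum>j<k. expectation (\<lambda>\<omega>. G (map \<sigma> (B i)) \<omega> * G (map \<sigma> (B j)) \<omega>))"
      using \<sigma>B[OF that] by (intro sum.cong refl Bochner_Integration.integral_sum intGG) auto
    finally have "expectation (\<lambda>\<omega>. (V \<sigma> \<omega>)\<^sup>2)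
        = (\<Sum>i<k. \<Sum>j<k. expectation (\<lambda>\<omega>. G (map \<sigma> (B i)) \<omega> * G (map \<sigma> (B j)) \<omega>)) / (real k)\<^sup>2"
      unfolding V_sq by simp
    also have "\<dots> = v / k"
      using k(1) by (simp add: cov[OF that] power2_eq_square)
    finally show "expectation (\<lambda>\<omega>. (V \<sigma> \<omega>)\<^sup>2) = v / k" .
  qed
  have U_eq: "U \<omega> = (\<Sum>\<sigma>\<in>?P. V \<sigma> \<omega>) / fact n" for \<omega>
  proof -
    have "(\<Sum>\<sigma>\<in>?P. V \<sigma> \<omega>) / fact n = (\<Sum>i<k. (\<Sum>\<sigma>\<in>?P. G (map \<sigma> (B i)) \<omega>) / fact n) / k"
      unfolding V_def sum_divide_distrib[symmetric] by (subst sum.swap) (simp add: field_simps)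
    \<comment> \<open>A random permutation turns each fixed block into a uniform draw, so every one
      of the \<open>k\<close> inner averages equals \<open>U\<close>.\<close>
    also have "\<dots> = (\<Sum>i<k. U \<omega>) / k"
      using sum_permutes_draw[OF B, of _ "\<lambda>l. G l \<omega>"] by (simp add: U_def G_def)
    finally show ?thesis using k(1) by simp
  qed
  \<comment> \<open>Jensen's inequality for the square, in the finite form of
    Cauchy-Schwarz.\<close>
  have U_le: "(U \<omega>)\<^sup>2 \<le> (\<Sum>\<sigma>\<in>?P. (V \<sigma> \<omega>)\<^sup>2) / fact n" for \<omega>
    using sum_squared_le_sum_of_squares[of "\<lambda>\<sigma>. V \<sigma> \<omega>" ?P]
    by (simp add: U_eq power_divide cardP power2_eq_square divide_simps)
  have iVs: "integrable M (\<lambda>\<omega>. (\<Sum>\<sigma>\<in>?P. (V \<sigma> \<omega>)\<^sup>2) / fact n)"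
    by (intro integrable_divide_zero Bochner_Integration.integrable_sum V) auto
  have Um: "U \<in> borel_measurable M"
    unfolding U_def G_def[symmetric, abs_def] using G_meas by (intro borel_measurable_divide borel_measurable_sum) auto
  show iU: "integrable M (\<lambda>\<omega>. (U \<omega>)\<^sup>2)"
    by (rule Bochner_Integration.integrable_bound[OF iVs])
      (use Um U_le in \<open>auto intro!: AE_I2 simp: sum_nonneg\<close>)
  have "expectation (\<lambda>\<omega>. (U \<omega>)\<^sup>2) \<le> expectation (\<lambda>\<omega>. (\<Sum>\<sigma>\<in>?P. (V \<sigma> \<omega>)\<^sup>2) / fact n)"
    by (intro integral_mono iU iVs U_le)
  also have "\<dots> = v / k"
    using V cardP by (simp add: Bochner_Integration.integral_sum)
  finally show "expectation (\<lambda>\<omega>. (U \<omega>)\<^sup>2) \<le> expectation (\<lambda>\<omega>. (g (block [0..<m] \<omega>))\<^sup>2) / k"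
    by (simp add: v_def)
qed

end

section \<open>Chatterjee's coefficient of random data\<close>

lemma insort_key_cong:
  "(\<And>x. x \<in> insert a (set s) \<Longrightarrow> f x = g x) \<Longrightarrow> insort_key f a s = insort_key g a s"
  by (induction s) auto

lemma sort_key_cong_set:
  "(\<And>x. x \<in> set s \<Longrightarrow> f x = g x) \<Longrightarrow> sort_key f s = sort_key g s"
  by (induction s) (auto intro!: insort_key_cong)

lemma chatterjee_xi_cong:
  assumes "\<And>k. k \<in> set t \<Longrightarrow> x k = x' k" "\<And>k. k \<in> set t \<Longrightarrow> y k = y' k"
  shows "chatterjee_xi c x y t = chatterjee_xi c x' y' t"
proof -
  have "sort_key x t = sort_key x' t" using assms(1) by (rule sort_key_cong_set)
  moreover have "map y (sort_key x' t) = map y' (sort_key x' t)"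
    using assms(2) by (intro map_cong) auto
  ultimately show ?thesis by (simp only: chatterjee_xi_def)
qed

lemma measurable_insort_key:
  fixes F :: "'k \<Rightarrow> 'a \<Rightarrow> real"
  assumes [measurable]: "\<And>k. F k \<in> borel_measurable M"
  shows "(\<lambda>\<omega>. insort_key (\<lambda>k. F k \<omega>) a s) \<in> measurable M (count_space UNIV)"
proof (induction s)
  case (Cons b s)
  have "(\<lambda>\<omega>. b # insort_key (\<lambda>k. F k \<omega>) a s) \<in> measurable M (count_space UNIV)"
    using measurable_compose[OF Cons, of "(#) b"] by simp
  then show ?case
    unfolding insort_key.simps
    by (intro measurable_If borel_measurable_le assms measurable_const) auto
qed simp

text \<open>The sorted tail has countably many possible values because the key type is countable. On
  each of the corresponding events one more insertion into a fixed list remains.\<close>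

lemma measurable_sort_key:
  fixes F :: "'k::countable \<Rightarrow> 'a \<Rightarrow> real"
  assumes F: "\<And>k. F k \<in> borel_measurable M"
  shows "(\<lambda>\<omega>. sort_key (\<lambda>k. F k \<omega>) s) \<in> measurable M (count_space UNIV)"
proof (induction s)
  case (Cons a s)
  show ?case
    unfolding sort_key_simps
    by (rule measurable_compose_countable[OF measurable_insort_key[OF F] Cons])
qed simp

lemma rank_le_eq_sum: "real (rank_le ys i) = (\<Sum>j<length ys. of_bool (ys ! j \<le> ys ! i))"
  by (simp add: rank_le_def of_bool_def sum.If_cases Int_def conj_commute)

lemma rank_ge_eq_sum: "real (rank_ge ys i) = (\<Sum>j<length ys. of_bool (ys ! i \<le> ys ! j))"
  by (simp add: rank_ge_def of_bool_def sum.If_cases Int_def conj_commute)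

text \<open>Ranks are finite sums of indicators of comparisons, and the case conditions are finite
  combinations of comparisons as well.\<close>

lemma measurable_xi_sorted:
  fixes F :: "'k \<Rightarrow> 'a \<Rightarrow> real"
  assumes [measurable]: "\<And>k. F k \<in> borel_measurable M"
  shows "(\<lambda>\<omega>. xi_sorted c (map (\<lambda>k. F k \<omega>) s)) \<in> borel_measurable M"
proof -
  have [measurable]: "(\<lambda>\<omega>. map (\<lambda>k. F k \<omega>) s ! i) \<in> borel_measurable M" if "i < length s" for i
    using that by simp
  have [measurable]: "(\<lambda>\<omega>. real (rank_le (map (\<lambda>k. F k \<omega>) s) i)) \<in> borel_measurable M"
    "(\<lambda>\<omega>. real (rank_ge (map (\<lambda>k. F k \<omega>) s) i)) \<in> borel_measurable M" if "i < length s" for i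
    using that by (simp_all add: rank_le_eq_sum rank_ge_eq_sum of_bool_def)
  have P1: "Measurable.pred M (\<lambda>\<omega>. distinct (map (\<lambda>k. F k \<omega>) s))"
    unfolding distinct_conv_nth by simp
  have D: "(\<lambda>\<omega>. \<Sum>i<length s - 1. \<bar>real (rank_le (map (\<lambda>k. F k \<omega>) s) (i + 1))
      - real (rank_le (map (\<lambda>k. F k \<omega>) s) i)\<bar>) \<in> borel_measurable M"
    by (intro borel_measurable_sum borel_measurable_abs borel_measurable_diff) simp_all
  have S: "(\<lambda>\<omega>. \<Sum>i<length s. real (rank_ge (map (\<lambda>k. F k \<omega>) s) i)
      * (real (length s) - real (rank_ge (map (\<lambda>k. F k \<omega>) s) i))) \<in> borel_measurable M"
    by (intro borel_measurable_sum borel_measurable_times borel_measurable_diff) simp_all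
  have P2: "Measurable.pred M (\<lambda>\<omega>. \<forall>i<length s. map (\<lambda>k. F k \<omega>) s ! i = map (\<lambda>k. F k \<omega>) s ! 0)"
    \<comment> \<open>For the empty list the entry at position 0 is unspecified, but then the
      quantifier is vacuous.\<close>
    by (cases "s = []") simp_all
  show ?thesis
    unfolding xi_sorted_def Let_def length_map
    by (intro measurable_If borel_measurable_diff borel_measurable_divide borel_measurable_times
      borel_measurable_const D S predE P1 P2)
qed

lemma measurable_chatterjee_xi:
  fixes F G :: "nat \<Rightarrow> 'a \<Rightarrow> real"
  assumes "\<And>k. k \<in> set t \<Longrightarrow> F k \<in> borel_measurable M"
    and "\<And>k. k \<in> set t \<Longrightarrow> G k \<in> borel_measurable M"
  shows "(\<lambda>\<omega>. chatterjee_xi c (\<lambda>k. F k \<omega>) (\<lambda>k. G k \<omega>) t) \<in> borel_measurable M"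
proof -
  \<comment> \<open>Keys outside \<open>t\<close> may fail to be measurable. Setting them to 0
    leaves the coefficient unchanged and makes every coordinate measurable.\<close>
  define F' where "F' k = (if k \<in> set t then F k else (\<lambda>_. 0))" for k
  define G' where "G' k = (if k \<in> set t then G k else (\<lambda>_. 0))" for k
  have F': "F' k \<in> borel_measurable M" and G': "G' k \<in> borel_measurable M" for k
    using assms by (auto simp: F'_def G'_def)
  have "(\<lambda>\<omega>. chatterjee_xi c (\<lambda>k. F' k \<omega>) (\<lambda>k. G' k \<omega>) t) \<in> borel_measurable M"
    unfolding chatterjee_xi_def
    by (rule measurable_compose_countable[OF measurable_xi_sorted[OF G'] measurable_sort_key[OF F']])
  moreover have "chatterjee_xi c (\<lambda>k. F' k \<omega>) (\<lambda>k. G' k \<omega>) t = chatterjee_xi c (\<lambda>k. F k \<omega>) (\<lambda>k. G k \<omega>) t" for \<omega>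
    by (rule chatterjee_xi_cong) (auto simp: F'_def G'_def)
  ultimately show ?thesis by simp
qed

text \<open>A crude bound by the length alone is enough: it is used for integrability at a fixed
  sample size, never in the limit. The ranks are at most \<open>n\<close>, so \<open>D\<close> is at
  most \<open>n^2\<close>, and a nonzero denominator is at least 1.\<close>

lemma xi_sorted_bounded:
  "\<bar>xi_sorted c ys\<bar> \<le> 1 + \<bar>c\<bar> + 3 * real (length ys) ^ 2 + real (length ys) ^ 3"
proof -
  define n where "n = length ys"
  define D where "D = (\<Sum>i<n - 1. \<bar>real (rank_le ys (i + 1)) - real (rank_le ys i)\<bar>)"
  \<comment> \<open>Taken as a natural number, \<open>S\<close> is either 0, where the quotient is 0
    by convention, or at least 1. The truncated subtraction is exact because ranks do not exceed
    \<open>n\<close>.\<close>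
  define S where "S = (\<Sum>i<n. rank_ge ys i * (n - rank_ge ys i))"
  have rank: "rank_le ys i \<le> n" "rank_ge ys i \<le> n" for i
    using card_mono[of "{..<n}" "{j. j < length ys \<and> ys ! j \<le> ys ! i}"]
      card_mono[of "{..<n}" "{j. j < length ys \<and> ys ! j \<ge> ys ! i}"]
    by (auto simp: rank_le_def rank_ge_def n_def)
  have S: "(\<Sum>i<n. real (rank_ge ys i) * (real n - real (rank_ge ys i))) = real S"
    by (simp add: S_def of_nat_diff rank)
  have "D \<le> (\<Sum>i<n - 1. real n)"
    unfolding D_def
    by (intro sum_mono) (use rank in \<open>smt (verit) of_nat_0_le_iff of_nat_le_iff\<close>)
  also have "\<dots> \<le> (real n)\<^sup>2"
    by (simp add: power2_eq_square mult_right_mono)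
  finally have D: "D \<le> (real n)\<^sup>2" "0 \<le> D" by (auto simp: D_def sum_nonneg)
  have 1: "\<bar>3 * D / ((real n)\<^sup>2 - 1)\<bar> \<le> 3 * (real n)\<^sup>2"
  proof (cases "n \<le> 1")
    case True
    \<comment> \<open>The sum is empty for \<open>n\<close> at most 1, so the degenerate denominator
      does no harm.\<close>
    then have "D = 0" by (simp add: D_def)
    then show ?thesis by simp
  next
    case False
    then have "2\<^sup>2 \<le> (real n)\<^sup>2" by (intro power_mono) auto
    then have n: "1 \<le> (real n)\<^sup>2 - 1" by simp
    have "3 * D / ((real n)\<^sup>2 - 1) \<le> 3 * D / 1"
      using n D by (intro divide_left_mono) auto
    then show ?thesis using n D by (simp add: abs_of_nonneg)
  qed
  have 2: "\<bar>real n * D / (2 * real S)\<bar> \<le> real n ^ 3"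
  proof (cases "S = 0")
    case False
    then have "real n * D / (2 * real S) \<le> real n * D / 1"
      using D by (intro divide_left_mono) auto
    also have "\<dots> \<le> real n * (real n)\<^sup>2" using D by (simp add: mult_left_mono)
    finally show ?thesis using D by (simp add: power2_eq_square power3_eq_cube mult.assoc)
  qed simp
  have "xi_sorted c ys = (if distinct ys then 1 - 3 * D / ((real n)\<^sup>2 - 1)
     else if \<forall>i<n. ys ! i = ys ! 0 then c else 1 - real n * D / (2 * real S))"
    unfolding xi_sorted_def Let_def S[symmetric] D_def n_def ..
  then consider "xi_sorted c ys = 1 - 3 * D / ((real n)\<^sup>2 - 1)" | "xi_sorted c ys = c"
    | "xi_sorted c ys = 1 - real n * D / (2 * real S)"
    by presburger
  then have "\<bar>xi_sorted c ys\<bar> \<le> 1 + \<bar>c\<bar> + 3 * (real n)\<^sup>2 + real n ^ 3"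
    using 1 2 zero_le_power2[of "real n"] zero_le_power[of "real n" 3] by cases linarith+
  then show ?thesis by (simp add: n_def)
qed

lemma chatterjee_xi_bounded:
  "\<bar>chatterjee_xi c x y t\<bar> \<le> 1 + \<bar>c\<bar> + 3 * real (length t) ^ 2 + real (length t) ^ 3"
  using xi_sorted_bounded[of c "map y (sort_key x t)"] by (simp add: chatterjee_xi_def)

section \<open>Averaging over an independent uniform choice\<close>

text \<open>Almost surely the variable is the sum over \<open>d\<close> in \<open>Q\<close> of
  \<open>F d W\<close> times the indicator of \<open>q = d\<close>. Independence factors each
  summand, and every event \<open>q = d\<close> has probability \<open>1 / card Q\<close>.\<close>

lemma (in prob_space) expectation_indep_uniform:
  fixes q :: "'a \<Rightarrow> 'd::countable" and F :: "'d \<Rightarrow> 'b \<Rightarrow> real"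
  assumes ind: "independent_rvs M N W (count_space UNIV) q"
    and unif: "distr M (count_space UNIV) q = measure_pmf (pmf_of_set Q)"
    and Q: "finite Q" "Q \<noteq> {}"
    and F: "\<And>d. F d \<in> borel_measurable N"
    and int: "\<And>d. d \<in> Q \<Longrightarrow> integrable M (\<lambda>\<omega>. F d (W \<omega>))"
  shows "integrable M (\<lambda>\<omega>. F (q \<omega>) (W \<omega>))"
    "expectation (\<lambda>\<omega>. F (q \<omega>) (W \<omega>)) = (\<Sum>d\<in>Q. expectation (\<lambda>\<omega>. F d (W \<omega>))) / card Q"
proof -
  have W [measurable]: "W \<in> measurable M N" and q [measurable]: "q \<in> measurable M (count_space UNIV)"
    and indset: "indep_set
      (sigma_sets (space M) {W -` A \<inter> space M |A. A \<in> sets N})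
      (sigma_sets (space M) {q -` B \<inter> space M |B. B \<in> sets (count_space UNIV)})"
    using ind by (auto simp: independent_rvs_def)
  note F [measurable]
  \<comment> \<open>Independence is given for the sigma-algebras generated by \<open>W\<close> and
    \<open>q\<close>. Real functions of them generate smaller ones, so they inherit it.\<close>
  have comp: "{h -` A \<inter> space M |A. A \<in> sets borel} \<subseteq> {g -` B \<inter> space M |B. B \<in> sets K}"
    if g: "g \<in> measurable M K" and f: "f \<in> borel_measurable K" and h: "h = f \<circ> g"
    for h :: "'a \<Rightarrow> real" and g :: "'a \<Rightarrow> 'e" and f K
  proof safe
    fix A :: "real set" assume "A \<in> sets borel"
    then show "\<exists>B. h -` A \<inter> space M = g -` B \<inter> space M \<and> B \<in> sets K"
      using measurable_space[OF g] measurable_sets[OF f]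
      by (intro exI[of _ "f -` A \<inter> space K"]) (auto simp: h)
  qed
  have indep: "indep_var borel (\<lambda>\<omega>. F d (W \<omega>)) borel (\<lambda>\<omega>. indicat_real {d} (q \<omega>))" for d
    unfolding indep_var_eq
  proof safe
    have "{(\<lambda>\<omega>. F d (W \<omega>)) -` A \<inter> space M |A. A \<in> sets borel} \<subseteq> {W -` A \<inter> space M |A. A \<in> sets N}"
      by (rule comp[OF W F]) (simp add: comp_def)
    moreover have "{(\<lambda>\<omega>. indicat_real {d} (q \<omega>)) -` A \<inter> space M |A. A \<in> sets borel}
        \<subseteq> {q -` B \<inter> space M |B. B \<in> sets (count_space UNIV)}"
      by (rule comp[OF q, of "indicat_real {d}"]) (simp_all add: comp_def)
    ultimately show "indep_set
        (sigma_sets (space M) {(\<lambda>\<omega>. F d (W \<omega>)) -` A \<inter> space M |A. A \<in> sets borel})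
        (sigma_sets (space M) {(\<lambda>\<omega>. indicat_real {d} (q \<omega>)) -` A \<inter> space M |A. A \<in> sets borel})"
      using indset unfolding indep_set_def
      by (elim indep_sets_mono_sets) (simp split: bool.split add: sigma_sets_subseteq)
  qed measurable
  have prob_q: "expectation (\<lambda>\<omega>. indicat_real {d} (q \<omega>)) = 1 / card Q" if "d \<in> Q" for d
  proof -
    have "expectation (\<lambda>\<omega>. indicat_real {d} (q \<omega>)) = (LINT x|distr M (count_space UNIV) q. indicat_real {d} x)"
      by (subst integral_distr[OF q]) auto
    also have "\<dots> = 1 / card Q"
      using Q that by (simp add: unif measure_pmf_single)
    finally show ?thesis .
  qed
  have "AE x in distr M (count_space UNIV) q. x \<in> Q"
    unfolding unif AE_measure_pmf_iff using Q by simp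
  then have "AE \<omega> in M. q \<omega> \<in> Q"
    by (subst (asm) AE_distr_iff[OF q]) auto
  then have ae: "AE \<omega> in M. F (q \<omega>) (W \<omega>) = (\<Sum>d\<in>Q. F d (W \<omega>) * indicat_real {d} (q \<omega>))"
    by eventually_elim (use Q in \<open>simp add: indicator_def if_distrib sum.If_cases\<close>)
  have meas [measurable]: "(\<lambda>\<omega>. F (q \<omega>) (W \<omega>)) \<in> borel_measurable M"
    by (rule measurable_compose_countable[OF _ q]) simp
  have ind_int: "integrable M (\<lambda>\<omega>. indicat_real {d} (q \<omega>))" for d
    by (rule integrable_const_bound[where B = 1]) auto
  have i: "integrable M (\<lambda>\<omega>. F d (W \<omega>) * indicat_real {d} (q \<omega>))" if "d \<in> Q" for d
    by (rule indep_var_integrable[OF indep int[OF that] ind_int])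
  show "integrable M (\<lambda>\<omega>. F (q \<omega>) (W \<omega>))"
    by (subst integrable_cong_AE[OF _ _ ae]) (auto intro!: Bochner_Integration.integrable_sum i)
  have "expectation (\<lambda>\<omega>. F (q \<omega>) (W \<omega>)) = expectation (\<lambda>\<omega>. \<Sum>d\<in>Q. F d (W \<omega>) * indicat_real {d} (q \<omega>))"
    by (rule integral_cong_AE[OF _ _ ae]) auto
  also have "\<dots> = (\<Sum>d\<in>Q. expectation (\<lambda>\<omega>. F d (W \<omega>) * indicat_real {d} (q \<omega>)))"
    by (rule Bochner_Integration.integral_sum) (rule i)
  also have "\<dots> = (\<Sum>d\<in>Q. expectation (\<lambda>\<omega>. F d (W \<omega>)) * (1 / card Q))"
    by (intro sum.cong refl)
      (simp add: indep_var_lebesgue_integral[OF indep int ind_int] prob_q)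
  finally show "expectation (\<lambda>\<omega>. F (q \<omega>) (W \<omega>)) = (\<Sum>d\<in>Q. expectation (\<lambda>\<omega>. F d (W \<omega>))) / card Q"
    by (simp add: sum_divide_distrib)
qed

section \<open>The bootstrap\<close>

lemma uniformly_square_integrable_integrable:
  "uniformly_square_integrable M I f \<Longrightarrow> i \<in> I \<Longrightarrow> integrable M (\<lambda>x. (f i x)\<^sup>2)"
  by (simp add: uniformly_square_integrable_def uniformly_integrable_def)

text \<open>The data enter as one sequence of pairs, so that the coefficient becomes a function on
  the product space in which blocks and the whole sequence take their values.\<close>

definition xi_data :: "real \<Rightarrow> (nat \<Rightarrow> real \<times> real) \<Rightarrow> nat list \<Rightarrow> real" where
  "xi_data c w t = chatterjee_xi c (\<lambda>k. fst (w k)) (\<lambda>k. snd (w k)) t"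

lemma xi_data_cong: "(\<And>k. k \<in> set t \<Longrightarrow> w k = w' k) \<Longrightarrow> xi_data c w t = xi_data c w' t"
  unfolding xi_data_def by (rule chatterjee_xi_cong) auto

lemma measurable_xi_data:
  assumes "\<And>k. k \<in> set t \<Longrightarrow> (\<lambda>\<omega>. W \<omega> k) \<in> borel_measurable M"
  shows "(\<lambda>\<omega>. xi_data c (W \<omega>) t) \<in> borel_measurable M"
  unfolding xi_data_def
proof (rule measurable_chatterjee_xi)
  have m: "(\<lambda>\<omega>. W \<omega> k) \<in> measurable M (borel \<Otimes>\<^sub>M borel)" if "k \<in> set t" for k
    using assms[OF that] by (simp add: borel_prod)
  show "(\<lambda>\<omega>. fst (W \<omega> k)) \<in> borel_measurable M" "(\<lambda>\<omega>. snd (W \<omega> k)) \<in> borel_measurable M"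
    if "k \<in> set t" for k
    using m[OF that] by (auto intro: measurable_compose)
qed

lemma xi_data_bounded:
  "\<bar>xi_data c w t\<bar> \<le> 1 + \<bar>c\<bar> + 3 * real (length t) ^ 2 + real (length t) ^ 3"
  unfolding xi_data_def by (rule chatterjee_xi_bounded)

text \<open>The kernel of the U-statistic; \<open>fact m\<close> is the number of tie-breaking
  enumerations.\<close>

definition avg_xi :: "real \<Rightarrow> nat \<Rightarrow> (nat \<Rightarrow> real \<times> real) \<Rightarrow> real" where
  "avg_xi c m w = (\<Sum>t\<in>permutations_of_set {..<m}. xi_data c w t) / fact m"

lemma set_permutation: "t \<in> permutations_of_set {..<m} \<Longrightarrow> set t = {..<m}"
  "t \<in> permutations_of_set {..<m} \<Longrightarrow> length t = m"
  using distinct_card[of t] by (auto simp: permutations_of_set_def)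

lemma measurable_avg_xi:
  assumes "\<And>k. k < m \<Longrightarrow> (\<lambda>\<omega>. W \<omega> k) \<in> borel_measurable M"
  shows "(\<lambda>\<omega>. avg_xi c m (W \<omega>)) \<in> borel_measurable M"
  unfolding avg_xi_def
  by (intro borel_measurable_divide borel_measurable_sum measurable_xi_data borel_measurable_const)
    (use assms set_permutation in auto)

text \<open>For a fixed sample size the coefficient is bounded, so a Borel function of this kind
  keeps it integrable. The class contains the test functions used below: identity, shifts, centred
  squares and indicators.\<close>

definition locally_bounded :: "(real \<Rightarrow> real) \<Rightarrow> bool" where
  "locally_bounded h \<longleftrightarrow> (\<forall>r. \<exists>C. \<forall>x. \<bar>x\<bar> \<le> r \<longrightarrow> \<bar>h x\<bar> \<le> C)"

lemma locally_bounded_continuous: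
  assumes "continuous_on UNIV h" shows "locally_bounded h"
  unfolding locally_bounded_def
proof
  fix r :: real
  have "compact (h ` {-r..r})"
    by (intro compact_continuous_image continuous_on_subset[OF assms]) auto
  then have "bounded (h ` {-r..r})" by (rule compact_imp_bounded)
  then obtain C where C: "\<And>y. y \<in> h ` {-r..r} \<Longrightarrow> norm y \<le> C" by (auto simp: bounded_iff)
  have "\<bar>h x\<bar> \<le> C" if "\<bar>x\<bar> \<le> r" for x
    using C[OF imageI, of x] that by (simp add: abs_le_iff)
  then show "\<exists>C. \<forall>x. \<bar>x\<bar> \<le> r \<longrightarrow> \<bar>h x\<bar> \<le> C" by blast
qed

lemma locally_bounded_id: "locally_bounded (\<lambda>x. x)"
  by (auto simp: locally_bounded_def)

lemma locally_bounded_indicator: "locally_bounded (indicator A)"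
  unfolding locally_bounded_def by (intro allI exI[of _ 1]) (simp add: indicator_def)

locale iid_pairs = prob_space +
  fixes X Y :: "nat \<Rightarrow> 'a \<Rightarrow> real"
  assumes pairs_indep: "indep_vars (\<lambda>_. borel) (\<lambda>k \<omega>. (X k \<omega>, Y k \<omega>)) UNIV"
    and pairs_ident: "\<And>k. distr M borel (\<lambda>\<omega>. (X k \<omega>, Y k \<omega>)) = distr M borel (\<lambda>\<omega>. (X 0 \<omega>, Y 0 \<omega>))"
begin

sublocale iid_sequence M borel "\<lambda>k \<omega>. (X k \<omega>, Y k \<omega>)"
  using pairs_indep pairs_ident by unfold_locales

lemma chatterjee_xi_eq_block:
  "t \<in> permutations_of_set {..<length l} \<Longrightarrow>
    chatterjee_xi c (\<lambda>j. X (l ! j) \<omega>) (\<lambda>j. Y (l ! j) \<omega>) t = xi_data c (block l \<omega>) t"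
  unfolding xi_data_def
  by (rule chatterjee_xi_cong) (auto simp: block_def set_permutation(1))

lemma integrable_xi_block:
  assumes "locally_bounded h" and [measurable]: "h \<in> borel_measurable borel"
    and "t \<in> permutations_of_set {..<length l}"
  shows "integrable M (\<lambda>\<omega>. h (xi_data c (block l \<omega>) t))"
proof -
  obtain C where C: "\<And>x. \<bar>x\<bar> \<le> 1 + \<bar>c\<bar> + 3 * real (length t) ^ 2 + real (length t) ^ 3 \<Longrightarrow> \<bar>h x\<bar> \<le> C"
    using assms(1) unfolding locally_bounded_def by blast
  have [measurable]: "(\<lambda>\<omega>. xi_data c (block l \<omega>) t) \<in> borel_measurable M"
    by (rule measurable_xi_data) (use Z_measurable set_permutation(1)[OF assms(3)] in \<open>simp add: block_def\<close>)
  show ?thesis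
    by (rule integrable_const_bound[where B = C]) (auto intro!: C xi_data_bounded)
qed

text \<open>Draws have distinct entries, so the corresponding block has the law of the first
  \<open>m\<close> observations.\<close>

lemma expectation_xi_block:
  fixes h :: "real \<Rightarrow> real"
  assumes "l \<in> draws m n" "0 < m" "t \<in> permutations_of_set {..<m}"
    and [measurable]: "h \<in> borel_measurable borel"
  shows "expectation (\<lambda>\<omega>. h (xi_data c (block l \<omega>) t))
    = expectation (\<lambda>\<omega>. h (xi_data c (block [0..<m] \<omega>) t))"
proof -
  have l: "length l = m" "distinct l" "l \<noteq> []" using assms by (auto simp: draws_def)
  have [measurable]: "(\<lambda>w. xi_data c w t) \<in> borel_measurable (Pi\<^sub>M {..<m} (\<lambda>_. borel))"
    by (rule measurable_xi_data) (use set_permutation(1)[OF assms(3)] in \<open>simp add: measurable_component_singleton\<close>)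
  have bm: "block l \<in> measurable M (Pi\<^sub>M {..<m} (\<lambda>_. borel))"
    "block [0..<m] \<in> measurable M (Pi\<^sub>M {..<m} (\<lambda>_. borel))"
    using block_measurable[of l] block_measurable[of "[0..<m]"] l by simp_all
  have "distr M (Pi\<^sub>M {..<m} (\<lambda>_. borel)) (block l) = distr M (Pi\<^sub>M {..<m} (\<lambda>_. borel)) (block [0..<m])"
    using distr_block_eq[of l "[0..<m]"] l by simp
  then show ?thesis
    using integral_distr[OF bm(1), of "\<lambda>w. h (xi_data c w t)"]
      integral_distr[OF bm(2), of "\<lambda>w. h (xi_data c w t)"] by simp
qed

lemma data_measurable: "(\<lambda>\<omega> k. (X k \<omega>, Y k \<omega>)) \<in> measurable M (Pi\<^sub>M UNIV (\<lambda>_. borel))"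
  by (rule measurable_PiM_single') (auto simp: Z_measurable)

lemma measurable_xi_data_PiM:
  "(\<lambda>z. xi_data c (\<lambda>j. z (s j)) t) \<in> borel_measurable (Pi\<^sub>M UNIV (\<lambda>_. borel))"
  by (rule measurable_xi_data) (simp add: measurable_component_singleton)

lemma expectation_xi_stat:
  assumes unif: "distr M (count_space UNIV) (tie m) = measure_pmf (pmf_of_set (permutations_of_set {..<m}))"
    and ind: "independent_rvs M (Pi\<^sub>M UNIV (\<lambda>_. borel)) (\<lambda>\<omega> k. (X k \<omega>, Y k \<omega>)) (count_space UNIV) (tie m)"
    and h: "locally_bounded h" and [measurable]: "h \<in> borel_measurable borel"
  shows "integrable M (\<lambda>\<omega>. h (xi_stat c X Y tie m \<omega>))"
    "expectation (\<lambda>\<omega>. h (xi_stat c X Y tie m \<omega>))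
      = (\<Sum>t\<in>permutations_of_set {..<m}. expectation (\<lambda>\<omega>. h (xi_data c (block [0..<m] \<omega>) t))) / fact m"
proof -
  have F: "(\<lambda>z. h (xi_data c z t)) \<in> borel_measurable (Pi\<^sub>M UNIV (\<lambda>_. borel))" for t
    using measurable_xi_data_PiM[of c "\<lambda>j. j" t] by simp
  have eq: "xi_data c (\<lambda>k. (X k \<omega>, Y k \<omega>)) t = xi_data c (block [0..<m] \<omega>) t"
    if "t \<in> permutations_of_set {..<m}" for t \<omega>
    by (rule xi_data_cong) (use set_permutation(1)[OF that] in \<open>auto simp: block_def\<close>)
  have int: "integrable M (\<lambda>\<omega>. h (xi_data c (\<lambda>k. (X k \<omega>, Y k \<omega>)) t))"
    if "t \<in> permutations_of_set {..<m}" for t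
    using integrable_xi_block[OF h, of t "[0..<m]" c] that by (simp add: eq[OF that])
  note E = expectation_indep_uniform[OF ind unif, of "\<lambda>t z. h (xi_data c z t)"]
  have stat: "xi_stat c X Y tie m \<omega> = xi_data c (\<lambda>k. (X k \<omega>, Y k \<omega>)) (tie m \<omega>)" for \<omega>
    by (simp add: xi_stat_def xi_data_def)
  show "integrable M (\<lambda>\<omega>. h (xi_stat c X Y tie m \<omega>))"
    unfolding stat by (rule E(1)) (use F int in auto)
  show "expectation (\<lambda>\<omega>. h (xi_stat c X Y tie m \<omega>))
      = (\<Sum>t\<in>permutations_of_set {..<m}. expectation (\<lambda>\<omega>. h (xi_data c (block [0..<m] \<omega>) t))) / fact m"
    unfolding stat by (subst E(2)) (use F int in \<open>auto simp: eq\<close>)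
qed

lemma xi_stat_measurable:
  assumes "tie m \<in> measurable M (count_space UNIV)"
  shows "xi_stat c X Y tie m \<in> borel_measurable M"
proof -
  have "(\<lambda>\<omega>. xi_data c (\<lambda>k. (X k \<omega>, Y k \<omega>)) t) \<in> borel_measurable M" for t
    by (rule measurable_xi_data) (rule Z_measurable)
  from measurable_compose_countable[OF this assms]
  show ?thesis by (simp add: xi_stat_def[abs_def] xi_data_def)
qed

lemma sample_algebra_subalgebra: "subalgebra M (sample_algebra M X Y n)"
proof -
  let ?V = "\<lambda>\<omega>. \<lambda>k\<in>{..<n}. (X k \<omega>, Y k \<omega>)"
  have V: "?V \<in> measurable M (Pi\<^sub>M {..<n} (\<lambda>_. borel))"
    by (rule measurable_restrict) (rule Z_measurable)
  show ?thesis
    unfolding subalgebra_def sample_algebra_def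
    using measurable_sets[OF V] measurable_space[OF V]
    by (auto simp: sets_vimage_algebra2 Pi_iff)
qed

section \<open>The resample at a fixed sample size\<close>

context
  fixes m n :: nat and s u :: "nat \<Rightarrow> 'a \<Rightarrow> nat list" and T :: "'a \<Rightarrow> nat list"
  assumes mn: "0 < m" "m < n"
    and unif: "distr M (count_space UNIV) (\<lambda>\<omega>. (s n \<omega>, u n \<omega>))
      = measure_pmf (pair_pmf (pmf_of_set (draws m n)) (pmf_of_set (permutations_of_set {..<m})))"
    and ind: "independent_rvs M
      (Pi\<^sub>M UNIV (\<lambda>_. borel) \<Otimes>\<^sub>M count_space UNIV) (\<lambda>\<omega>. (\<lambda>k. (X k \<omega>, Y k \<omega>), T \<omega>))
      (count_space UNIV) (\<lambda>\<omega>. (s n \<omega>, u n \<omega>))"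
begin

abbreviation (input) "outcomes \<equiv> draws m n \<times> permutations_of_set {..<m}"

lemma outcomes: "finite outcomes" "outcomes \<noteq> {}"
  "card outcomes = card (draws m n) * fact m" "0 < card (draws m n)"
proof -
  have d: "finite (draws m n)" "draws m n \<noteq> {}"
    using finite_draws draws_nonempty[of m n] mn(2) by simp_all
  then show "finite outcomes" by (intro finite_cartesian_product) auto
  from d show "0 < card (draws m n)" unfolding card_gt_0_iff by blast
  show "outcomes \<noteq> {}" using d(2) by simp
  show "card outcomes = card (draws m n) * fact m" unfolding card_cartesian_product by simp
qed

text \<open>Draw and tie-breaking together form one uniform choice from \<open>outcomes\<close>,
  independent of the data. The weight \<open>a\<close> is a bounded function of the data:
  \<open>a = 1\<close> gives the law of the resampled coefficient, and the indicator of a sample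
  event gives its conditional expectation.\<close>

lemma expectation_xi_boot:
  assumes a: "a \<in> borel_measurable (Pi\<^sub>M UNIV (\<lambda>_. borel))" "\<And>z. \<bar>a z\<bar> \<le> 1"
    and h: "locally_bounded h" and [measurable]: "h \<in> borel_measurable borel"
  shows "integrable M (\<lambda>\<omega>. a (\<lambda>k. (X k \<omega>, Y k \<omega>)) * h (xi_boot c X Y s u n \<omega>))"
    "expectation (\<lambda>\<omega>. a (\<lambda>k. (X k \<omega>, Y k \<omega>)) * h (xi_boot c X Y s u n \<omega>))
      = (\<Sum>(l, t)\<in>outcomes.
          expectation (\<lambda>\<omega>. a (\<lambda>k. (X k \<omega>, Y k \<omega>)) * h (xi_data c (block l \<omega>) t))) / card outcomes"
    "\<And>l t. (l, t) \<in> outcomes \<Longrightarrow>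
      integrable M (\<lambda>\<omega>. a (\<lambda>k. (X k \<omega>, Y k \<omega>)) * h (xi_data c (block l \<omega>) t))"
proof -
  \<comment> \<open>The argument is the pair of data and \<open>T\<close>, because that pair is the
    variable of which the choice is assumed independent.\<close>
  define F where "F d zt = a (fst zt) * h (xi_data c (\<lambda>j. fst zt (fst d ! j)) (snd d))"
    for d :: "nat list \<times> nat list" and zt :: "(nat \<Rightarrow> real \<times> real) \<times> nat list"
  have F: "F d \<in> borel_measurable (Pi\<^sub>M UNIV (\<lambda>_. borel) \<Otimes>\<^sub>M count_space UNIV)" for d
    unfolding F_def
    by (intro borel_measurable_times measurable_compose[OF measurable_fst] a
      measurable_compose[OF measurable_xi_data_PiM]) measurable
  have eq: "xi_data c (\<lambda>j. (X (l ! j) \<omega>, Y (l ! j) \<omega>)) t = xi_data c (block l \<omega>) t"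
    if "(l, t) \<in> outcomes" for l t \<omega>
    using that chatterjee_xi_eq_block[of t l c \<omega>] by (simp add: xi_data_def draws_def)
  have a': "(\<lambda>\<omega>. a (\<lambda>k. (X k \<omega>, Y k \<omega>))) \<in> borel_measurable M"
    by (rule measurable_compose[OF data_measurable a(1)])
  show int: "integrable M (\<lambda>\<omega>. a (\<lambda>k. (X k \<omega>, Y k \<omega>)) * h (xi_data c (block l \<omega>) t))"
    if "(l, t) \<in> outcomes" for l t
  proof -
    have i: "integrable M (\<lambda>\<omega>. h (xi_data c (block l \<omega>) t))"
      using that by (intro integrable_xi_block h) (auto simp: draws_def)
    show ?thesis
      by (rule Bochner_Integration.integrable_bound[OF i])
        (use a' borel_measurable_integrable[OF i] a(2) in
          \<open>auto intro!: borel_measurable_times AE_I2 mult_left_le_one_le simp: abs_mult\<close>)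
  qed
  have intF: "integrable M (\<lambda>\<omega>. F d (\<lambda>k. (X k \<omega>, Y k \<omega>), T \<omega>))" if "d \<in> outcomes" for d
    using int[of "fst d" "snd d"] eq[of "fst d" "snd d"] that by (simp add: F_def)
  \<comment> \<open>The product of two uniform laws is the uniform law on the product set.\<close>
  have unif': "distr M (count_space UNIV) (\<lambda>\<omega>. (s n \<omega>, u n \<omega>)) = measure_pmf (pmf_of_set outcomes)"
    unfolding unif
  proof (rule arg_cong[where f = measure_pmf], rule pmf_eqI)
    fix d :: "nat list \<times> nat list"
    have "draws m n \<noteq> {}" using outcomes(2) by blast
    then have "pmf (pmf_of_set (draws m n)) l = indicator (draws m n) l / card (draws m n)" for l
      by (rule pmf_of_set) (rule finite_draws)
    then show "pmf (pair_pmf (pmf_of_set (draws m n)) (pmf_of_set (permutations_of_set {..<m}))) d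
        = pmf (pmf_of_set outcomes) d"
      unfolding pmf_of_set[OF outcomes(2,1)] outcomes(3)
      by (cases d) (simp add: pmf_pair indicator_def)
  qed
  note E = expectation_indep_uniform[where F = F, OF ind unif' outcomes(1,2) F intF]
  have boot: "(\<lambda>\<omega>. a (\<lambda>k. (X k \<omega>, Y k \<omega>)) * h (xi_boot c X Y s u n \<omega>))
      = (\<lambda>\<omega>. F (s n \<omega>, u n \<omega>) (\<lambda>k. (X k \<omega>, Y k \<omega>), T \<omega>))"
    by (simp add: F_def xi_boot_def xi_data_def)
  show "integrable M (\<lambda>\<omega>. a (\<lambda>k. (X k \<omega>, Y k \<omega>)) * h (xi_boot c X Y s u n \<omega>))"
    unfolding boot by (rule E(1))
  show "expectation (\<lambda>\<omega>. a (\<lambda>k. (X k \<omega>, Y k \<omega>)) * h (xi_boot c X Y s u n \<omega>))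
      = (\<Sum>(l, t)\<in>outcomes.
          expectation (\<lambda>\<omega>. a (\<lambda>k. (X k \<omega>, Y k \<omega>)) * h (xi_data c (block l \<omega>) t))) / card outcomes"
    unfolding boot
  proof (subst E(2))
    show "(\<Sum>d\<in>outcomes. expectation (\<lambda>\<omega>. F d (\<lambda>k. (X k \<omega>, Y k \<omega>), T \<omega>))) / card outcomes
      = (\<Sum>(l, t)\<in>outcomes.
          expectation (\<lambda>\<omega>. a (\<lambda>k. (X k \<omega>, Y k \<omega>)) * h (xi_data c (block l \<omega>) t))) / card outcomes"
      by (intro arg_cong2[where f = "(/)"] sum.cong refl) (auto simp: F_def eq)
  qed
qed

lemma integrable_xi_boot: "integrable M (xi_boot c X Y s u n)"
proof -
  have "integrable M (\<lambda>\<omega>. 1 * xi_boot c X Y s u n \<omega>)"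
    by (rule expectation_xi_boot(1)[where a = "\<lambda>_. 1" and h = "\<lambda>x. x"])
      (simp_all add: locally_bounded_id)
  then show ?thesis unfolding mult_1 .
qed

lemma xi_boot_measurable: "xi_boot c X Y s u n \<in> borel_measurable M"
  by (rule borel_measurable_integrable) (rule integrable_xi_boot)

text \<open>Tested on indicators, both laws are averages over the tie-breaking. In the bootstrap
  average the summand does not depend on the draw, because distinct indices of an iid sequence are
  interchangeable.\<close>

lemma distr_xi_boot:
  assumes tie: "distr M (count_space UNIV) (tie m) = measure_pmf (pmf_of_set (permutations_of_set {..<m}))"
    "independent_rvs M (Pi\<^sub>M UNIV (\<lambda>_. borel)) (\<lambda>\<omega> k. (X k \<omega>, Y k \<omega>)) (count_space UNIV) (tie m)"
  shows "distr M borel (xi_boot c X Y s u n) = distr M borel (xi_stat c X Y tie m)"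
proof (rule measure_eqI)
  fix A :: "real set" assume "A \<in> sets (distr M borel (xi_boot c X Y s u n))"
  then have A [measurable]: "A \<in> sets borel" by simp
  have tm: "tie m \<in> measurable M (count_space UNIV)"
    using tie(2) by (simp add: independent_rvs_def)
  note tm = xi_stat_measurable[where tie = tie and m = m, OF tm]
  have ind_eq: "(\<lambda>\<omega>. indicat_real A (f \<omega>)) = indicator (f -` A)" for f :: "'a \<Rightarrow> real"
    by (auto simp: indicator_def)
  have prob: "prob (f -` A \<inter> space M) = expectation (\<lambda>\<omega>. indicat_real A (f \<omega>))"
    if "f \<in> borel_measurable M" for f
    using that by (simp add: ind_eq Int_commute)
  let ?e = "\<lambda>l t. expectation (\<lambda>\<omega>. indicat_real A (xi_data c (block l \<omega>) t))"
  have "expectation (\<lambda>\<omega>. indicat_real A (xi_boot c X Y s u n \<omega>)) = (\<Sum>(l, t)\<in>outcomes. ?e l t) / card outcomes"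
    using expectation_xi_boot(2)[where a = "\<lambda>_. 1" and h = "indicator A",
        OF borel_measurable_const _ locally_bounded_indicator]
    by simp
  also have "(\<Sum>(l, t)\<in>outcomes. ?e l t) = (\<Sum>(l, t)\<in>outcomes. ?e [0..<m] t)"
    using expectation_xi_block[of _ m n _ "indicator A" c] mn by (intro sum.cong refl) auto
  also have "\<dots> / card outcomes = (\<Sum>t\<in>permutations_of_set {..<m}. ?e [0..<m] t) / fact m"
    using outcomes(4) by (simp add: outcomes(3) sum.cartesian_product[symmetric])
  also have "\<dots> = expectation (\<lambda>\<omega>. indicat_real A (xi_stat c X Y tie m \<omega>))"
    by (rule expectation_xi_stat(2)[where tie = tie and m = m and h = "indicator A", symmetric])
      (simp_all add: tie locally_bounded_indicator)
  finally show "emeasure (distr M borel (xi_boot c X Y s u n)) A = emeasure (distr M borel (xi_stat c X Y tie m)) A"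
    using prob[OF xi_boot_measurable] prob[OF tm]
    by (simp add: emeasure_distr xi_boot_measurable tm emeasure_eq_measure)
qed simp

definition U_stat :: "real \<Rightarrow> 'a \<Rightarrow> real" where
  "U_stat c \<omega> = (\<Sum>l\<in>draws m n. avg_xi c m (block l \<omega>)) / card (draws m n)"

lemma U_stat_measurable: "U_stat c \<in> borel_measurable M"
  unfolding U_stat_def[abs_def]
  by (intro borel_measurable_divide borel_measurable_sum measurable_avg_xi borel_measurable_const)
    (simp add: block_def draws_def Z_measurable)

text \<open>\<open>U_stat\<close> is a function of the sample, and its integral over each sample
  event agrees with that of the resampled coefficient: both equal the same average over
  \<open>outcomes\<close>.\<close>

lemma cond_exp_xi_boot:
  "AE \<omega> in M. real_cond_exp M (sample_algebra M X Y n) (xi_boot c X Y s u n) \<omega> = U_stat c \<omega>"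
proof -
  let ?S = "sample_algebra M X Y n"
  let ?V = "\<lambda>\<omega>. \<lambda>k\<in>{..<n}. (X k \<omega>, Y k \<omega>)"
  have V: "?V \<in> space M \<rightarrow> space (Pi\<^sub>M {..<n} (\<lambda>_. borel))" by (auto simp: space_PiM)
  have VS: "?V \<in> measurable ?S (Pi\<^sub>M {..<n} (\<lambda>_. borel))"
    unfolding sample_algebra_def by (rule measurable_vimage_algebra1[OF V])
  interpret finite_measure_subalgebra M ?S
    by unfold_locales (rule sample_algebra_subalgebra)
  have U_sum: "a * U_stat c \<omega> = (\<Sum>(l, t)\<in>outcomes. a * xi_data c (block l \<omega>) t) / card outcomes"
    for a \<omega>
    unfolding U_stat_def avg_xi_def outcomes(3) sum.cartesian_product[symmetric]
    by (simp add: sum_divide_distrib sum_distrib_left mult.commute)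
  show ?thesis
  proof (rule real_cond_exp_charact)
    show "integrable M (xi_boot c X Y s u n)" by (rule integrable_xi_boot)
    have "integrable M (\<lambda>\<omega>. (\<Sum>(l, t)\<in>outcomes. 1 * xi_data c (block l \<omega>) t) / card outcomes)"
      using expectation_xi_boot(3)[where a = "\<lambda>_. 1" and h = "\<lambda>x. x",
          OF borel_measurable_const _ locally_bounded_id]
      by (intro integrable_divide_zero Bochner_Integration.integrable_sum) auto
    then show "integrable M (U_stat c)"
      unfolding U_sum[of 1, symmetric] unfolding mult_1 .
    \<comment> \<open>All drawn indices lie below \<open>n\<close>, so each entry of a block is a
      coordinate of the sample.\<close>
    have "(\<lambda>\<omega>. block l \<omega> j) \<in> measurable ?S borel" if l: "l \<in> draws m n" and j: "j < m" for l j
    proof -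
      have "l ! j < n" using l j by (auto simp: draws_def dest: nth_mem)
      then have "(\<lambda>\<omega>. ?V \<omega> (l ! j)) \<in> measurable ?S borel"
        by (intro measurable_compose[OF VS measurable_component_singleton]) auto
      then show ?thesis using l j \<open>l ! j < n\<close> by (simp add: block_def draws_def)
    qed
    then show "U_stat c \<in> borel_measurable ?S"
      unfolding U_stat_def[abs_def]
      by (intro borel_measurable_divide borel_measurable_sum measurable_avg_xi) auto
    fix A assume "A \<in> sets ?S"
    then obtain A' where A': "A' \<in> sets (Pi\<^sub>M {..<n} (\<lambda>_. borel))" and A: "A = ?V -` A' \<inter> space M"
      unfolding sample_algebra_def sets_vimage_algebra2[OF V] by auto
    \<comment> \<open>The indicator of the event, written as a function of the whole sequence that
      looks only at its first \<open>n\<close> terms.\<close>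
    define a where "a z = indicat_real A' (restrict z {..<n})" for z :: "nat \<Rightarrow> real \<times> real"
    have a: "a \<in> borel_measurable (Pi\<^sub>M UNIV (\<lambda>_. borel))" "\<bar>a z\<bar> \<le> 1" for z
    proof -
      have "(\<lambda>z. restrict z {..<n}) \<in> measurable (Pi\<^sub>M UNIV (\<lambda>_. borel)) (Pi\<^sub>M {..<n} (\<lambda>_. borel :: (real \<times> real) measure))"
        by (rule measurable_restrict_subset) simp
      then show "a \<in> borel_measurable (Pi\<^sub>M UNIV (\<lambda>_. borel))"
        unfolding a_def by (rule measurable_compose) (rule borel_measurable_indicator[OF A'])
    qed (simp add: a_def indicator_def)
    have set_int: "(LINT \<omega>:A|M. f \<omega>) = expectation (\<lambda>\<omega>. a (\<lambda>k. (X k \<omega>, Y k \<omega>)) * f \<omega>)" for f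
      unfolding set_lebesgue_integral_def
      by (intro Bochner_Integration.integral_cong refl) (auto simp: a_def A indicator_def)
    have "(LINT \<omega>:A|M. U_stat c \<omega>) = (\<Sum>(l, t)\<in>outcomes.
        expectation (\<lambda>\<omega>. a (\<lambda>k. (X k \<omega>, Y k \<omega>)) * xi_data c (block l \<omega>) t)) / card outcomes"
      using expectation_xi_boot(3)[where a = a and h = "\<lambda>x. x", OF a locally_bounded_id, of _ _ c]
      unfolding set_int U_sum integral_divide_zero
      by (subst Bochner_Integration.integral_sum) (auto simp: case_prod_unfold)
    then show "(LINT \<omega>:A|M. xi_boot c X Y s u n \<omega>) = (LINT \<omega>:A|M. U_stat c \<omega>)"
      using expectation_xi_boot(2)[where a = a and h = "\<lambda>x. x", OF a locally_bounded_id, of c] unfolding set_int by simp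
  qed
qed

text \<open>Two convexity bounds are combined: averaging over tie-breaking does not increase the
  second moment of the centred coefficient, and the U-statistic bound then applies to the averaged
  kernel.\<close>

lemma U_stat_variance_le:
  fixes c :: real
  assumes tie: "distr M (count_space UNIV) (tie m) = measure_pmf (pmf_of_set (permutations_of_set {..<m}))"
    "independent_rvs M (Pi\<^sub>M UNIV (\<lambda>_. borel)) (\<lambda>\<omega> k. (X k \<omega>, Y k \<omega>)) (count_space UNIV) (tie m)"
  defines "\<mu> \<equiv> expectation (xi_stat c X Y tie m)"
  shows "integrable M (\<lambda>\<omega>. (U_stat c \<omega> - \<mu>)\<^sup>2)"
    "expectation (\<lambda>\<omega>. (U_stat c \<omega> - \<mu>)\<^sup>2)
      \<le> expectation (\<lambda>\<omega>. (xi_stat c X Y tie m \<omega> - \<mu>)\<^sup>2) / (n div m)"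
proof -
  define g where "g w = avg_xi c m w - \<mu>" for w
  let ?b = "block [0..<m]" and ?Q = "permutations_of_set {..<m}"
  have Q: "finite ?Q" "card ?Q = fact m" by simp_all
  have [measurable]: "g \<in> borel_measurable (Pi\<^sub>M {..<m} (\<lambda>_. borel))"
    unfolding g_def
    by (intro borel_measurable_diff measurable_avg_xi borel_measurable_const)
      (simp add: measurable_component_singleton)
  have g_sum: "g w = (\<Sum>t\<in>?Q. xi_data c w t - \<mu>) / fact m" for w
    by (simp add: g_def avg_xi_def sum_subtractf diff_divide_distrib)
  have g_sq: "(g w)\<^sup>2 \<le> (\<Sum>t\<in>?Q. (xi_data c w t - \<mu>)\<^sup>2) / fact m" for w
    using sum_squared_le_sum_of_squares[of "\<lambda>t. xi_data c w t - \<mu>" ?Q]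
    by (simp add: g_sum power_divide power2_eq_square divide_simps)
  have bm: "?b \<in> measurable M (Pi\<^sub>M {..<m} (\<lambda>_. borel))"
    using block_measurable[of "[0..<m]"] by simp
  have gb [measurable]: "(\<lambda>\<omega>. g (?b \<omega>)) \<in> borel_measurable M"
    by (rule measurable_compose[OF bm]) measurable
  have id: "locally_bounded (\<lambda>x. x - \<mu>)" and sq: "locally_bounded (\<lambda>x. (x - \<mu>)\<^sup>2)"
    by (auto intro!: locally_bounded_continuous continuous_intros)
  note i1 = integrable_xi_block[OF id, of _ "[0..<m]" c] and i2 = integrable_xi_block[OF sq, of _ "[0..<m]" c]
  note e1 = expectation_xi_stat[where tie = tie and m = m, OF tie id, of c]
    and e2 = expectation_xi_stat[where tie = tie and m = m, OF tie sq, of c]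
  have i2s: "integrable M (\<lambda>\<omega>. (\<Sum>t\<in>?Q. (xi_data c (?b \<omega>) t - \<mu>)\<^sup>2) / fact m)"
    by (intro integrable_divide_zero Bochner_Integration.integrable_sum i2) auto
  have ig: "integrable M (\<lambda>\<omega>. (g (?b \<omega>))\<^sup>2)"
    by (rule Bochner_Integration.integrable_bound[OF i2s]) (use g_sq in \<open>auto simp: sum_nonneg\<close>)
  have "expectation (\<lambda>\<omega>. g (?b \<omega>)) = (\<Sum>t\<in>?Q. expectation (\<lambda>\<omega>. xi_data c (?b \<omega>) t - \<mu>)) / fact m"
    unfolding g_sum integral_divide_zero
    by (subst Bochner_Integration.integral_sum) (auto intro!: i1)
  also have "\<dots> = expectation (\<lambda>\<omega>. xi_stat c X Y tie m \<omega> - \<mu>)"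
    by (rule e1(2)[symmetric]) measurable
  also have "\<dots> = 0"
    using expectation_xi_stat(1)[where tie = tie and m = m, OF tie locally_bounded_id, of c]
    by (simp add: \<mu>_def prob_space)
  finally have cent: "expectation (\<lambda>\<omega>. g (?b \<omega>)) = 0" .
  have "expectation (\<lambda>\<omega>. (g (?b \<omega>))\<^sup>2) \<le> expectation (\<lambda>\<omega>. (\<Sum>t\<in>?Q. (xi_data c (?b \<omega>) t - \<mu>)\<^sup>2) / fact m)"
    by (intro integral_mono ig i2s g_sq)
  also have "\<dots> = (\<Sum>t\<in>?Q. expectation (\<lambda>\<omega>. (xi_data c (?b \<omega>) t - \<mu>)\<^sup>2)) / fact m"
    unfolding integral_divide_zero by (subst Bochner_Integration.integral_sum) (auto intro!: i2)
  also have "\<dots> = expectation (\<lambda>\<omega>. (xi_stat c X Y tie m \<omega> - \<mu>)\<^sup>2)"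
    by (rule e2(2)[symmetric]) measurable
  finally have g2: "expectation (\<lambda>\<omega>. (g (?b \<omega>))\<^sup>2) \<le> expectation (\<lambda>\<omega>. (xi_stat c X Y tie m \<omega> - \<mu>)\<^sup>2)" .
  \<comment> \<open>This is the largest number of disjoint blocks of length \<open>m\<close> that
    fit into the sample.\<close>
  have k: "0 < n div m" "n div m * m \<le> n"
    using mn by (auto simp: div_greater_zero_iff)
  have U: "(\<Sum>l\<in>draws m n. g (block l \<omega>)) / card (draws m n) = U_stat c \<omega> - \<mu>" for \<omega>
    using outcomes(4) by (simp add: g_def U_stat_def sum_subtractf diff_divide_distrib)
  note le = U_statistic_second_moment_le[OF _ mn(1) k ig cent, unfolded U]
  show "integrable M (\<lambda>\<omega>. (U_stat c \<omega> - \<mu>)\<^sup>2)"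
    by (rule le(1)) measurable
  have "expectation (\<lambda>\<omega>. (U_stat c \<omega> - \<mu>)\<^sup>2) \<le> expectation (\<lambda>\<omega>. (g (?b \<omega>))\<^sup>2) / (n div m)"
    by (rule le(2)) measurable
  also have "\<dots> \<le> expectation (\<lambda>\<omega>. (xi_stat c X Y tie m \<omega> - \<mu>)\<^sup>2) / (n div m)"
    using g2 by (intro divide_right_mono) auto
  finally show "expectation (\<lambda>\<omega>. (U_stat c \<omega> - \<mu>)\<^sup>2)
      \<le> expectation (\<lambda>\<omega>. (xi_stat c X Y tie m \<omega> - \<mu>)\<^sup>2) / (n div m)" .
qed

end

end

section \<open>The block count, the normal limit and the conclusion\<close>

text \<open>The remainder of \<open>n\<close> modulo \<open>m\<close> is less than \<open>m\<close>,
  hence at most \<open>m * (n div m)\<close>; this doubles the product and is the origin of the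
  factor 2.\<close>

lemma inverse_div_le:
  fixes m n :: nat
  assumes "0 < m" "m \<le> n"
  shows "1 / real (n div m) \<le> 2 * (real m / real n)"
proof -
  have d: "1 \<le> n div m" using assms by (simp add: Suc_le_eq div_greater_zero_iff)
  have "n = m * (n div m) + n mod m" by simp
  also have "\<dots> \<le> m * (n div m) + m * (n div m)"
    using assms d mod_less_divisor[of m n] mult_le_mono2[OF d, of m] by linarith
  finally have "n \<le> 2 * m * (n div m)" by simp
  then have "real n \<le> 2 * real m * real (n div m)"
    by (metis of_nat_le_iff of_nat_mult of_nat_numeral)
  then show ?thesis using assms d by (simp add: field_simps)
qed

lemma real_distribution_normal:
  assumes "0 < \<sigma>"
  shows "real_distribution (density lborel (normal_density 0 \<sigma>))"
  unfolding real_distribution_def real_distribution_axioms_def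
  using prob_space_normal_density[OF assms] by simp

lemma second_moment_normal:
  assumes "0 < \<sigma>"
  shows "integrable (density lborel (normal_density 0 \<sigma>)) (\<lambda>x. x\<^sup>2)"
  using integrable_normal_moment[OF assms, of 0 2] by (simp add: integrable_real_density)

theorem theorem2:
  fixes M :: "'a measure"
    and X Y :: "'a \<Rightarrow> real"
    and Xs Ys :: "nat \<Rightarrow> 'a \<Rightarrow> real"
    and tie draw boot_tie :: "nat \<Rightarrow> 'a \<Rightarrow> nat list"
    and m :: "nat \<Rightarrow> nat"
    and c \<sigma> :: real
  assumes M: "prob_space M"
    and generic: "X \<in> borel_measurable M" "Y \<in> borel_measurable M"
    and indep: "prob_space.indep_vars M (\<lambda>_. borel) (\<lambda>k \<omega>. (Xs k \<omega>, Ys k \<omega>)) UNIV"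
    and ident: "\<And>k. distr M borel (\<lambda>\<omega>. (Xs k \<omega>, Ys k \<omega>)) = distr M borel (\<lambda>\<omega>. (X \<omega>, Y \<omega>))"
    and c: "c \<in> {-1..1}"
    and tie_unif:
      "\<And>n. distr M (count_space UNIV) (tie n) = measure_pmf (pmf_of_set (permutations_of_set {..<n}))"
    and tie_indep:
      "\<And>n. independent_rvs M
        (Pi\<^sub>M UNIV (\<lambda>_. borel)) (\<lambda>\<omega> k. (Xs k \<omega>, Ys k \<omega>))
        (count_space UNIV) (tie n)"
    and m_less: "\<forall>\<^sub>F n in sequentially. m n < n"
    and m_at_top: "filterlim m at_top sequentially"
    and boot_unif:
      "\<And>n. m n < n \<Longrightarrow> distr M (count_space UNIV) (\<lambda>\<omega>. (draw n \<omega>, boot_tie n \<omega>))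
        = measure_pmf (pair_pmf (pmf_of_set (draws (m n) n))
                                (pmf_of_set (permutations_of_set {..<m n})))"
    and boot_indep:
      "\<And>n. m n < n \<Longrightarrow> independent_rvs M
        (Pi\<^sub>M UNIV (\<lambda>_. borel) \<Otimes>\<^sub>M count_space UNIV) (\<lambda>\<omega>. (\<lambda>k. (Xs k \<omega>, Ys k \<omega>), tie n \<omega>))
        (count_space UNIV) (\<lambda>\<omega>. (draw n \<omega>, boot_tie n \<omega>))"
    and sigma: "\<sigma> > 0"
    and clt: "weak_conv_m (\<lambda>n. distr M borel (T_stat M c Xs Ys tie n))
        (density lborel (normal_density 0 \<sigma>))"
    and cond:
      "(\<lambda>n. real (m n)) \<in> o(\<lambda>n. sqrt (real n)) \<or>
       (continuous_on UNIV (\<lambda>(s, t). measure M {\<omega> \<in> space M. X \<omega> \<le> s \<and> Y \<omega> \<le> t}) \<and>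
        \<not> (\<exists>f \<in> borel_measurable borel. AE \<omega> in M. Y \<omega> = f (X \<omega>)) \<and>
        (\<lambda>n. real (m n)) \<in> o(\<lambda>n. real n))"
    and usi: "uniformly_square_integrable M {2..} (T_stat M c Xs Ys tie)"
  shows "((\<lambda>n. wasserstein 2 (distr M borel (T_boot M c Xs Ys draw boot_tie m n))
      (density lborel (normal_density 0 \<sigma>))) \<longlongrightarrow> 0) sequentially"
proof -
  interpret prob_space M by fact
  have "prob_space.indep_vars M (\<lambda>_. borel) (\<lambda>k \<omega>. (Xs k \<omega>, Ys k \<omega>)) UNIV" by fact
  then interpret iid_pairs M Xs Ys
    by unfold_locales (simp_all only: ident)
  define \<nu> where "\<nu> = density lborel (normal_density 0 \<sigma>)"
  have \<nu>: "real_distribution \<nu>"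
    unfolding \<nu>_def by (rule real_distribution_normal[OF sigma])
  have \<nu>2: "integrable \<nu> (\<lambda>x. x\<^sup>2)"
    unfolding \<nu>_def by (rule second_moment_normal[OF sigma])
  define v where "v = (LINT x|\<nu>. x\<^sup>2)"
  have "\<forall>\<^sub>F n in sequentially. m n < n \<and> 2 \<le> m n"
    using m_less filterlim_at_top[THEN iffD1, OF m_at_top, rule_format, of 2] by eventually_elim simp
  \<comment> \<open>A resample size of at least 2 lies in the index range of \<open>usi\<close>, so
    \<open>T_stat\<close> is square-integrable there.\<close>
  then obtain n0 where n0: "\<And>n. n0 \<le> n \<Longrightarrow> m n < n \<and> 2 \<le> m n"
    by (auto simp: eventually_sequentially)
  \<comment> \<open>For small indices \<open>draw\<close> is unconstrained and the bootstrap statistic may fail to be measurable.\<close>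
  define a where "a n = n + n0" for n
  define p where "p n = m (a n)" for n
  have a_top: "filterlim a at_top sequentially"
    unfolding a_def by (rule filterlim_add_const_nat_at_top)
  have p_top: "filterlim p at_top sequentially"
    unfolding p_def by (rule filterlim_compose[OF m_at_top a_top])
  have p: "0 < p n" "p n < a n" "2 \<le> p n" for n
    using n0[of "a n"] by (auto simp: p_def a_def)

  have "(\<lambda>n. real (m n)) \<in> o(\<lambda>n. real n)"
    using cond
  proof
    assume "(\<lambda>n. real (m n)) \<in> o(\<lambda>n. sqrt (real n))"
    moreover have "(\<lambda>n. sqrt (real n)) \<in> O(\<lambda>n. real n)"
      by real_asymp
    ultimately show ?thesis by (rule landau_o.small_big_trans)
  qed blast
  then have "(\<lambda>n. real (m n) / real n) \<longlonglongrightarrow> 0"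
    by (rule smalloD_tendsto)
  from filterlim_compose[OF this a_top]
  have ratio: "(\<lambda>n. real (p n) / real (a n)) \<longlonglongrightarrow> 0" by (simp add: p_def)

  define \<mu> where "\<mu> n = expectation (xi_stat c Xs Ys tie n)" for n
  define T where "T n = T_stat M c Xs Ys tie (p n)" for n
  \<comment> \<open>The bootstrap statistic recentred at the constant mean; unlike \<open>Z\<close>,
    it has exactly the law of \<open>T\<close>.\<close>
  define S where "S n \<omega> = sqrt (p n) * (xi_boot c Xs Ys draw boot_tie (a n) \<omega> - \<mu> (p n))" for n \<omega>
  define Z where "Z n = T_boot M c Xs Ys draw boot_tie m (a n)" for n
  have tm: "tie n \<in> measurable M (count_space UNIV)" for n
    using tie_indep[of n] by (simp add: independent_rvs_def)
  have xm [measurable]: "xi_stat c Xs Ys tie n \<in> borel_measurable M" for n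
    by (rule xi_stat_measurable) (rule tm)
  note boot = p(1,2) boot_unif[of "a n" for n, folded p_def, OF p(2)]
    boot_indep[of "a n" for n, folded p_def, OF p(2)]
  have bm [measurable]: "xi_boot c Xs Ys draw boot_tie (a n) \<in> borel_measurable M" for n
    by (rule xi_boot_measurable[where s = draw and u = boot_tie and n = "a n" and m = "p n"
        and T = "tie (a n)", OF boot])
  have T_all_meas [measurable]: "T_stat M c Xs Ys tie n \<in> borel_measurable M" for n
    unfolding T_stat_def[abs_def] by measurable
  have T_meas [measurable]: "T n \<in> borel_measurable M" for n unfolding T_def by (rule T_all_meas)
  have S_meas [measurable]: "S n \<in> borel_measurable M" for n unfolding S_def[abs_def] by measurable
  have Z_meas [measurable]: "Z n \<in> borel_measurable M" for n
    unfolding Z_def T_boot_def[abs_def]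
    by (intro borel_measurable_times borel_measurable_diff borel_measurable_const bm
      borel_measurable_cond_exp2)

  have distr_S: "distr M borel (S n) = distr M borel (T n)" for n
  proof -
    let ?\<phi> = "\<lambda>x. sqrt (p n) * (x - \<mu> (p n))"
    have "distr M borel (S n) = distr (distr M borel (xi_boot c Xs Ys draw boot_tie (a n))) borel ?\<phi>"
      by (subst distr_distr) (simp_all add: S_def[abs_def] comp_def)
    also have "\<dots> = distr (distr M borel (xi_stat c Xs Ys tie (p n))) borel ?\<phi>"
      by (subst distr_xi_boot[where s = draw and u = boot_tie and n = "a n" and m = "p n"
        and T = "tie (a n)"
        and tie = tie, OF boot tie_unif tie_indep]) (rule refl)
    also have "\<dots> = distr M borel (T n)"
      by (subst distr_distr) (simp_all add: T_def T_stat_def[abs_def] comp_def \<mu>_def)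
    finally show ?thesis .
  qed

  \<comment> \<open>Only \<open>p\<close> tending to infinity is used; \<open>p\<close> need not be
    monotone.\<close>
  have weak_S: "weak_conv_m (\<lambda>n. distr M borel (S n)) \<nu>"
    using clt filterlim_compose[OF _ p_top]
    unfolding distr_S T_def weak_conv_m_def weak_conv_def \<nu>_def[symmetric] by blast
  have "(\<lambda>n. expectation (\<lambda>\<omega>. (T_stat M c Xs Ys tie n \<omega>)\<^sup>2)) \<longlonglongrightarrow> v"
    unfolding v_def using clt[folded \<nu>_def]
    by (intro second_moment_of_uniformly_square_integrable[OF T_all_meas usi \<nu> _ \<nu>2])
  from filterlim_compose[OF this p_top]
  have T2: "(\<lambda>n. expectation (\<lambda>\<omega>. (T n \<omega>)\<^sup>2)) \<longlonglongrightarrow> v" by (simp add: T_def)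
  have T2_int: "integrable M (\<lambda>\<omega>. (T n \<omega>)\<^sup>2)" for n
    unfolding T_def by (rule uniformly_square_integrable_integrable[OF usi]) (use p(3) in simp)
  have S2_int: "integrable M (\<lambda>\<omega>. (S n \<omega>)\<^sup>2)" for n
    using T2_int[of n] integrable_distr_eq[OF T_meas, of "\<lambda>x. x\<^sup>2" n]
      integrable_distr_eq[OF S_meas, of "\<lambda>x. x\<^sup>2" n] by (simp add: distr_S)
  have "expectation (\<lambda>\<omega>. (S n \<omega>)\<^sup>2) = expectation (\<lambda>\<omega>. (T n \<omega>)\<^sup>2)" for n
    using integral_distr[OF T_meas, of "\<lambda>x. x\<^sup>2" n] integral_distr[OF S_meas, of "\<lambda>x. x\<^sup>2" n]
    by (simp add: distr_S)
  then have S2: "(\<lambda>n. expectation (\<lambda>\<omega>. (S n \<omega>)\<^sup>2)) \<longlonglongrightarrow> v"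
    using T2 by simp

  define U where "U n = U_stat (p n) (a n) c" for n
  have ae: "AE \<omega> in M. (Z n \<omega> - S n \<omega>)\<^sup>2 = p n * (U n \<omega> - \<mu> (p n))\<^sup>2" for n
    using cond_exp_xi_boot[where s = draw and u = boot_tie and n = "a n" and m = "p n"
        and T = "tie (a n)", OF boot, of c]
  proof eventually_elim
    case (elim \<omega>)
    \<comment> \<open>The resampled coefficient cancels, and only the difference of the two centres
      remains.\<close>
    have "Z n \<omega> - S n \<omega> = sqrt (p n) * (\<mu> (p n) - U n \<omega>)"
      by (simp add: Z_def S_def T_boot_def elim U_def p_def[symmetric] algebra_simps)
    then show ?case by (simp add: power_mult_distrib power2_commute)
  qed
  note U_var = U_stat_variance_le[where s = draw and u = boot_tie and n = "a n" and m = "p n"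
    and T = "tie (a n)" and tie = tie for n, OF boot tie_unif tie_indep, of _ c, folded U_def \<mu>_def]
  have Um [measurable]: "U n \<in> borel_measurable M" for n
    unfolding U_def by (rule U_stat_measurable[where s = draw and u = boot_tie and n = "a n" and m = "p n"
        and T = "tie (a n)", OF boot])
  have D_int: "integrable M (\<lambda>\<omega>. (Z n \<omega> - S n \<omega>)\<^sup>2)" for n
    by (subst integrable_cong_AE[OF _ _ ae]) (use U_var(1) in auto)
  have D_le: "expectation (\<lambda>\<omega>. (Z n \<omega> - S n \<omega>)\<^sup>2)
      \<le> expectation (\<lambda>\<omega>. (T n \<omega>)\<^sup>2) * (2 * (real (p n) / real (a n)))" for n
  proof -
    have T_eq: "(T n \<omega>)\<^sup>2 = p n * (xi_stat c Xs Ys tie (p n) \<omega> - \<mu> (p n))\<^sup>2" for \<omega>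
      by (simp add: T_def T_stat_def \<mu>_def power_mult_distrib)
    have "expectation (\<lambda>\<omega>. (Z n \<omega> - S n \<omega>)\<^sup>2) = p n * expectation (\<lambda>\<omega>. (U n \<omega> - \<mu> (p n))\<^sup>2)"
      by (subst integral_cong_AE[OF _ _ ae]) auto
    also have "\<dots> \<le> p n * (expectation (\<lambda>\<omega>. (xi_stat c Xs Ys tie (p n) \<omega> - \<mu> (p n))\<^sup>2) / (a n div p n))"
      by (intro mult_left_mono U_var(2)) simp
    \<comment> \<open>The factor \<open>p n\<close> turns the variance of the coefficient into the
      second moment of \<open>T n\<close>, which converges.\<close>
    also have "\<dots> = expectation (\<lambda>\<omega>. (T n \<omega>)\<^sup>2) * (1 / (a n div p n))"
      by (simp add: T_eq)
    also have "\<dots> \<le> expectation (\<lambda>\<omega>. (T n \<omega>)\<^sup>2) * (2 * (real (p n) / real (a n)))"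
      by (intro mult_left_mono inverse_div_le) (use p in \<open>auto intro: less_imp_le\<close>)
    finally show ?thesis .
  qed
  have "(\<lambda>n. expectation (\<lambda>\<omega>. (T n \<omega>)\<^sup>2) * (2 * (real (p n) / real (a n)))) \<longlonglongrightarrow> v * (2 * 0)"
    by (intro tendsto_mult tendsto_const T2 ratio)
  then have bound: "(\<lambda>n. expectation (\<lambda>\<omega>. (T n \<omega>)\<^sup>2) * (2 * (real (p n) / real (a n)))) \<longlonglongrightarrow> 0"
    unfolding mult_zero_right .
  have D: "(\<lambda>n. expectation (\<lambda>\<omega>. (Z n \<omega> - S n \<omega>)\<^sup>2)) \<longlonglongrightarrow> 0"
    by (rule real_tendsto_sandwich[OF _ always_eventually[OF allI[OF D_le]] tendsto_const bound]) simp

  have weak_Z: "weak_conv_m (\<lambda>n. distr M borel (Z n)) \<nu>"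
    by (rule weak_conv_m_L2_perturbation[OF S_meas Z_meas \<nu> weak_S D_int D])
  note Z2 = second_moment_L2_perturbation[OF S_meas Z_meas S2_int S2 D_int D]
  have "(\<lambda>n. wasserstein 2 (distr M borel (Z n)) \<nu>) \<longlonglongrightarrow> 0"
  proof (rule wasserstein_2_tendsto_0[OF _ \<nu> weak_Z _ \<nu>2])
    show "real_distribution (distr M borel (Z n))" for n by (rule real_distribution_distr) (rule Z_meas)
    show "integrable (distr M borel (Z n)) (\<lambda>x. x\<^sup>2)" for n
      using Z2(1)[of n] by (simp add: integrable_distr_eq)
    show "(\<lambda>n. LINT x|distr M borel (Z n). x\<^sup>2) \<longlonglongrightarrow> (LINT x|\<nu>. x\<^sup>2)"
      using Z2(2) by (simp add: integral_distr v_def)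
  qed
  \<comment> \<open>The limit is unaffected by the shift \<open>n0\<close> built into
    \<open>a\<close>.\<close>
  then show ?thesis
    unfolding Z_def a_def \<nu>_def by (rule LIMSEQ_offset)
qed

end
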